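(* The set $\{\delta^{k}e_4^{\,i}e_6^{\,j}\mid i,j,k\in\mathbb{Z}_{\ge0}\}$ is a $\mathbb{C}$-basis of $\mathcal{R}$.
   Context: Let $\mathrm{Hol}$ be the space of holomorphic functions on the upper half plane, $q=e^{2\pi iz}$, $f'=\frac{1}{2\pi i}\frac{df}{dz}$, and $E_2,E_4,E_6$ the Eisenstein series with constant term $1$. For $k\in\mathbb{R}$ let $D_kf=f'-\frac{k}{12}E_2f$. Let $H=\bigoplus_{n\in\mathbb{R}}H_n$ where each $H_n$ is a copy of $\mathrm{Hol}$, elements of $H_n$ being written $(f,n)$; $H$ is a graded commutative $\mathbb{C}$-algebra via $(f,n)(g,m)=(fg,n+m)$. Let $\mathrm{End}(H)=\bigoplus_{i\in\mathbb{R}}\mathrm{End}^i(H)$, where $\mathrm{End}^i(H)$ consists of the $\mathbb{C}$-linear maps $H\to H$ sending $H_n$ into $H_{n+i}$ for all $n$. Define $\delta,e_4,e_6\in\mathrm{End}(H)$ by $\delta(f,n)=(D_nf,n+2)$, $e_4(f,n)=(E_4f,n+4)$, $e_6(f,n)=(E_6f,n+6)$. $\mathcal{R}$ is the $\mathbb{C}$-subalgebra of $\mathrm{End}(H)$ generated by $\delta,e_4,e_6$. *)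

theory Defs
  imports "HOL-Analysis.Analysis"
begin

type_synonym hel = "real \<Rightarrow> complex \<Rightarrow> complex"
  (* an element of H: the component of degree n is h n, a function on the upper half plane
     (extended by 0 off the upper half plane); finitely many nonzero components *)
type_synonym op = "hel \<Rightarrow> hel"

definition uhp :: "complex set" where "uhp = {z. 0 < Im z}"

definition divsum :: "nat \<Rightarrow> nat \<Rightarrow> nat" where
  "divsum k n = (\<Sum>d\<in>{d. d dvd n}. d ^ k)"

definition qq :: "complex \<Rightarrow> complex" where "qq z = exp (2 * pi * \<i> * z)"

definition Eis :: "nat \<Rightarrow> complex \<Rightarrow> complex \<Rightarrow> complex" where
  "Eis k c z = 1 + c * (\<Sum>n. of_nat (divsum (k - 1) (Suc n)) * qq z ^ Suc n)"

definition E2 :: "complex \<Rightarrow> complex" where "E2 = Eis 2 (-24)"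
definition E4 :: "complex \<Rightarrow> complex" where "E4 = Eis 4 240"
definition E6 :: "complex \<Rightarrow> complex" where "E6 = Eis 6 (-504)"

definition Dk :: "real \<Rightarrow> (complex \<Rightarrow> complex) \<Rightarrow> complex \<Rightarrow> complex" where
  "Dk k f z = deriv f z / (2 * pi * \<i>) - complex_of_real k / 12 * E2 z * f z"

definition Hsp :: "hel set" where
  "Hsp = {h. finite {n. h n \<noteq> (\<lambda>z. 0)} \<and> (\<forall>n. h n holomorphic_on uhp)
             \<and> (\<forall>n z. z \<notin> uhp \<longrightarrow> h n z = 0)}"

(* operators are considered as maps on H; outside H they are set to 0 *)
definition idH :: op where "idH h = (if h \<in> Hsp then h else (\<lambda>n z. 0))"

definition delta :: op where
  "delta h = (if h \<in> Hsp then (\<lambda>m z. if z \<in> uhp then Dk (m - 2) (h (m - 2)) z else 0)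
              else (\<lambda>n z. 0))"

definition e4 :: op where
  "e4 h = (if h \<in> Hsp then (\<lambda>m z. E4 z * h (m - 4) z) else (\<lambda>n z. 0))"

definition e6 :: op where
  "e6 h = (if h \<in> Hsp then (\<lambda>m z. E6 z * h (m - 6) z) else (\<lambda>n z. 0))"

datatype gen = Gd | G4 | G6

fun gen_op :: "gen \<Rightarrow> op" where
  "gen_op Gd = delta" | "gen_op G4 = e4" | "gen_op G6 = e6"

fun word_op :: "gen list \<Rightarrow> op" where
  "word_op [] = idH"
| "word_op (g # w) = gen_op g \<circ> word_op w"

definition lincomb :: "'a set \<Rightarrow> ('a \<Rightarrow> complex) \<Rightarrow> ('a \<Rightarrow> op) \<Rightarrow> op" where
  "lincomb S c F = (\<lambda>h n z. \<Sum>t\<in>S. c t * F t h n z)"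

(* the C-subalgebra of End(H) generated by delta, e4, e6: the span of all words *)
definition Ralg :: "op set" where
  "Ralg = {lincomb W c word_op | W c. finite W}"

definition mono :: "nat \<times> nat \<times> nat \<Rightarrow> op" where
  "mono t = (case t of (k, i, j) \<Rightarrow> (delta ^^ k) \<circ> (e4 ^^ i) \<circ> (e6 ^^ j) \<circ> idH)"

end

theory Submission
  imports Defs "HOL-Complex_Analysis.Complex_Analysis" "HOL-Real_Asymp.Real_Asymp"
begin

text \<open>
  Spanning: Ramanujan's identities \<open>3 E\<^sub>4' = E\<^sub>2 E\<^sub>4 - E\<^sub>6\<close> and \<open>2 E\<^sub>6' = E\<^sub>2 E\<^sub>6 - E\<^sub>4\<^sup>2\<close> give the commutators
  \<open>[e\<^sub>4, \<delta>] = e\<^sub>6 / 3\<close> and \<open>[e\<^sub>6, \<delta>] = e\<^sub>4\<^sup>2 / 2\<close>, by which \<open>\<delta>\<close> can be moved to the left without raising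
  its exponent. On coefficients, Ramanujan's identities are convolution formulas for divisor sums;
  they follow from a bijective argument of Liouville type on the solutions of \<open>a x + b y = n\<close>, applied to
  \<open>(x\<^sup>2 + x y + y\<^sup>2)\<^sup>2\<close>, \<open>(x\<^sup>2 + x y + y\<^sup>2)\<^sup>3\<close> and \<open>x\<^sup>2 y\<^sup>2 (x + y)\<^sup>2\<close>.

  Independence: let \<open>K\<close> be the largest exponent of \<open>\<delta>\<close> in a relation. Applying the relation to
  \<open>((z - w)\<^sup>K, 0)\<close> and evaluating at \<open>z = w\<close> leaves only the terms with \<open>\<delta>\<^sup>K\<close>, hence a linear relation
  between monomials \<open>E\<^sub>4\<^sup>i E\<^sub>6\<^sup>j\<close> of equal weight. Dividing by one of them gives a polynomial equation for
  \<open>E\<^sub>6\<^sup>2 / E\<^sub>4\<^sup>3\<close>, whose \<open>q\<close>-expansion is not constant.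
\<close>

section \<open>Convolutions of divisor sums\<close>

definition quads :: "nat \<Rightarrow> (nat \<times> nat \<times> nat \<times> nat) set" where
  "quads n = {(a, b, x, y). 0 < a \<and> 0 < b \<and> 0 < x \<and> 0 < y \<and> a * x + b * y = n}"

lemma finite_quads: "finite (quads n)"
proof (rule finite_subset)
  have "u \<le> u * v" if "0 < v" for u v :: nat using that by simp
  show "quads n \<subseteq> {..n} \<times> {..n} \<times> {..n} \<times> {..n}"
  proof (clarsimp simp: quads_def)
    fix a b x y :: nat assume p: "0 < a" "0 < b" "0 < x" "0 < y"
    have "a \<le> a * x" "x \<le> a * x" "b \<le> b * y" "y \<le> b * y" using p by auto
    then show "a \<le> a * x + b * y \<and> b \<le> a * x + b * y \<and> x \<le> a * x + b * y \<and> y \<le> a * x + b * y"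
      by linarith
  qed
qed simp

lemma sum_quads_swap:
  fixes g :: "nat \<Rightarrow> nat \<Rightarrow> nat \<Rightarrow> nat \<Rightarrow> int" and P :: "nat \<Rightarrow> nat \<Rightarrow> nat \<Rightarrow> nat \<Rightarrow> bool"
  shows
  "(\<Sum>(a, b, x, y)\<in>{(a, b, x, y)\<in>quads n. P b a y x}. g a b x y)
    = (\<Sum>(a, b, x, y)\<in>{(a, b, x, y)\<in>quads n. P a b x y}. g b a y x)"
  by (rule sum.reindex_bij_witness[where i = "\<lambda>(a, b, x, y). (b, a, y, x)"
        and j = "\<lambda>(a, b, x, y). (b, a, y, x)"]) (auto simp: quads_def)

text \<open>The map \<open>(a, b, x, y) \<mapsto> (a, a + b, x - y, y)\<close> keeps a x + b y and
  turns the condition y < x into a < b.\<close>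

lemma sum_quads_shear:
  fixes g :: "int \<Rightarrow> int \<Rightarrow> int"
  shows
  "(\<Sum>(a, b, x, y)\<in>{(a, b, x, y)\<in>quads n. y < x}. g (int a) (int b))
    = (\<Sum>(a, b, x, y)\<in>{(a, b, x, y)\<in>quads n. a < b}. g (int a) (int b - int a))"
  by (rule sum.reindex_bij_witness[where i = "\<lambda>(a, b, x, y). (a, b - a, x + y, y)"
        and j = "\<lambda>(a, b, x, y). (a, a + b, x - y, y)"])
     (auto simp: quads_def algebra_simps dest!: less_imp_Suc_add)

lemma sum_quads_split:
  fixes g :: "nat \<Rightarrow> nat \<Rightarrow> nat \<Rightarrow> nat \<Rightarrow> int" and u v :: "nat \<Rightarrow> nat \<Rightarrow> nat \<Rightarrow> nat \<Rightarrow> nat"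
  shows "(\<Sum>(a, b, x, y)\<in>quads n. g a b x y)
    = (\<Sum>(a, b, x, y)\<in>{(a, b, x, y)\<in>quads n. u a b x y < v a b x y}. g a b x y)
      + (\<Sum>(a, b, x, y)\<in>{(a, b, x, y)\<in>quads n. v a b x y < u a b x y}. g a b x y)
      + (\<Sum>(a, b, x, y)\<in>{(a, b, x, y)\<in>quads n. u a b x y = v a b x y}. g a b x y)"
proof -
  define A B C where "A = {(a, b, x, y)\<in>quads n. u a b x y < v a b x y}"
    and "B = {(a, b, x, y)\<in>quads n. v a b x y < u a b x y}"
    and "C = {(a, b, x, y)\<in>quads n. u a b x y = v a b x y}"
  have fin: "finite A" "finite B" "finite C"
    by (auto simp: A_def B_def C_def intro!: finite_subset[OF _ finite_quads[of n]])
  have "quads n = (A \<union> B) \<union> C" by (auto simp: A_def B_def C_def)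
  moreover have "(A \<union> B) \<inter> C = {}" "A \<inter> B = {}" by (auto simp: A_def B_def C_def)
  ultimately have "sum G (quads n) = sum G A + sum G B + sum G C"
    for G :: "nat \<times> nat \<times> nat \<times> nat \<Rightarrow> int"
    using fin by (simp add: sum.union_disjoint)
  then show ?thesis unfolding A_def B_def C_def .
qed

text \<open>For x = y the equation reads (a + b) x = n, so d = a + b runs through the divisors of n,
  and a through 1, ..., d - 1.\<close>

lemma sum_quads_diag_xy:
  fixes g :: "int \<Rightarrow> int \<Rightarrow> int"
  assumes "0 < n"
  shows "(\<Sum>(a, b, x, y)\<in>{(a, b, x, y)\<in>quads n. y = x}. g (int a) (int b))
    = (\<Sum>d\<in>{d. d dvd n}. \<Sum>a\<in>{1..<d}. g (int a) (int d - int a))"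
proof -
  have "(\<Sum>d\<in>{d. d dvd n}. \<Sum>a\<in>{1..<d}. g (int a) (int d - int a))
    = (\<Sum>(d, a)\<in>(SIGMA d:{d. d dvd n}. {1..<d}). g (int a) (int d - int a))"
    using assms by (intro sum.Sigma) auto
  also have "\<dots> = (\<Sum>(a, b, x, y)\<in>{(a, b, x, y)\<in>quads n. y = x}. g (int a) (int b))"
    by (rule sum.reindex_bij_witness[where j = "\<lambda>(d, a). (a, d - a, n div d, n div d)"
        and i = "\<lambda>(a, b, x, y). (a + b, a)"])
      (use assms in \<open>auto simp: quads_def add_mult_distrib[symmetric] elim!: dvdE\<close>)
  finally show ?thesis by simp
qed

text \<open>For a = b = d the equation reads d (x + y) = n, which leaves n/d - 1 choices for
  x.\<close>

lemma sum_quads_diag_ab: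
  fixes g :: "int \<Rightarrow> int \<Rightarrow> int"
  assumes "0 < n"
  shows "(\<Sum>(a, b, x, y)\<in>{(a, b, x, y)\<in>quads n. a = b}. g (int a) (int b))
    = (\<Sum>d\<in>{d. d dvd n}. (int (n div d) - 1) * g (int d) (int d))"
proof -
  have "(\<Sum>d\<in>{d. d dvd n}. (int (n div d) - 1) * g (int d) (int d))
     = (\<Sum>d\<in>{d. d dvd n}. \<Sum>x\<in>{1..<n div d}. g (int d) (int d))"
  proof (rule sum.cong)
    fix d assume "d \<in> {d. d dvd n}"
    then have "0 < n div d" using assms by (auto elim!: dvdE)
    then show "(int (n div d) - 1) * g (int d) (int d) = (\<Sum>x\<in>{1..<n div d}. g (int d) (int d))"
      by (simp add: of_nat_diff)
  qed simp
  also have "\<dots> = (\<Sum>(d, x)\<in>(SIGMA d:{d. d dvd n}. {1..<n div d}). g (int d) (int d))"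
    using assms by (intro sum.Sigma) auto
  also have "\<dots> = (\<Sum>(a, b, x, y)\<in>{(a, b, x, y)\<in>quads n. a = b}. g (int a) (int b))"
    by (rule sum.reindex_bij_witness[where j = "\<lambda>(d, x). (d, d, x, n div d - x)"
        and i = "\<lambda>(a, b, x, y). (a, x)"])
      (use assms in \<open>auto simp: quads_def add_mult_distrib2[symmetric] elim!: dvdE\<close>)
  finally show ?thesis by simp
qed

text \<open>In terms of \<open>z = - x - y\<close> the hypotheses say that \<open>f\<close> is even and symmetric in \<open>x, y, z\<close>.
  The subtractive Euclidean step \<open>(a, b, x, y) \<mapsto> (a, a + b, x - y, y)\<close> preserves \<open>a x + b y\<close>, so up to
  boundary terms the sum of \<open>f a b\<close> equals that of \<open>f a (- b)\<close>.\<close>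

lemma liouville_identity:
  fixes f :: "int \<Rightarrow> int \<Rightarrow> int"
  assumes n: "0 < n" and sym: "\<And>x y. f x y = f y x" and inv: "\<And>x y. f (- x) (x + y) = f x y"
  shows "(\<Sum>(a, b, x, y)\<in>quads n. f (int a) (int b) - f (int a) (- int b))
    = (\<Sum>d\<in>{d. d dvd n}. (\<Sum>a\<in>{1..<d}. f (int a) (int d - int a))
        - (int (n div d) - 1) * f (int d) (- int d))"
proof -
  \<comment> \<open>With \<open>sym\<close> this is evenness of \<open>f\<close>. By
    \<open>inv\<close> the two sides are \<open>f (- x) (x - y)\<close> and
    \<open>f (- y) (y - x)\<close>; a third use of \<open>inv\<close> identifies these.\<close>
  have neg: "f x (- y) = f y (- x)" for x y
    using inv[of x "- y"] inv[of y "- x"] inv[of "x - y" "- x"] sym by simp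
  have shear: "f x (y - x) = f x (- y)" for x y
    using inv[of x "y - x"] sym[of "- x" y] neg[of y x] by simp
  \<comment> \<open>Here the sign of b changes: shearing replaces f a b by f a (b - a), which equals
    f a (- b).\<close>
  have gt: "(\<Sum>(a, b, x, y)\<in>{(a, b, x, y)\<in>quads n. y < x}. f (int a) (int b))
      = (\<Sum>(a, b, x, y)\<in>{(a, b, x, y)\<in>quads n. a < b}. f (int a) (- int b))"
    unfolding sum_quads_shear shear ..
  have lt: "(\<Sum>(a, b, x, y)\<in>{(a, b, x, y)\<in>quads n. x < y}. f (int a) (int b))
      = (\<Sum>(a, b, x, y)\<in>{(a, b, x, y)\<in>quads n. y < x}. f (int a) (int b))"
    using sum_quads_swap[where P = "\<lambda>a b x y. y < x" and n = n and g = "\<lambda>a b x y. f (int a) (int b)"] sym by simp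
  have ba: "(\<Sum>(a, b, x, y)\<in>{(a, b, x, y)\<in>quads n. b < a}. f (int a) (- int b))
      = (\<Sum>(a, b, x, y)\<in>{(a, b, x, y)\<in>quads n. a < b}. f (int a) (- int b))"
    using sum_quads_swap[where P = "\<lambda>a b x y. a < b" and n = n and g = "\<lambda>a b x y. f (int a) (- int b)"] neg by simp
  \<comment> \<open>One sum is split by comparing x with y, the other by comparing a with b. Their
    off-diagonal parts agree and cancel in the difference, so only the two diagonals remain.\<close>
  have 1: "(\<Sum>(a, b, x, y)\<in>quads n. f (int a) (int b))
    = 2 * (\<Sum>(a, b, x, y)\<in>{(a, b, x, y)\<in>quads n. a < b}. f (int a) (- int b))
     + (\<Sum>d\<in>{d. d dvd n}. \<Sum>a\<in>{1..<d}. f (int a) (int d - int a))"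
    using sum_quads_split[of "\<lambda>a b x y. f (int a) (int b)" n "\<lambda>a b x y. y" "\<lambda>a b x y. x"]
      sum_quads_diag_xy[OF n, of f] gt lt by simp
  have 2: "(\<Sum>(a, b, x, y)\<in>quads n. f (int a) (- int b))
    = 2 * (\<Sum>(a, b, x, y)\<in>{(a, b, x, y)\<in>quads n. a < b}. f (int a) (- int b))
     + (\<Sum>d\<in>{d. d dvd n}. (int (n div d) - 1) * f (int d) (- int d))"
    using sum_quads_split[of "\<lambda>a b x y. f (int a) (- int b)" n "\<lambda>a b x y. a" "\<lambda>a b x y. b"]
      sum_quads_diag_ab[OF n, of "\<lambda>a b. f a (- b)"] ba by simp
  have "(\<Sum>(a, b, x, y)\<in>quads n. f (int a) (int b) - f (int a) (- int b))
    = (\<Sum>(a, b, x, y)\<in>quads n. f (int a) (int b)) - (\<Sum>(a, b, x, y)\<in>quads n. f (int a) (- int b))"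
    by (simp add: sum_subtractf case_prod_unfold)
  then show ?thesis unfolding 1 2 by (simp add: sum_subtractf)
qed

text \<open>The coefficient of q^n in the product of the generating series of
  \<open>divsum i\<close> and \<open>divsum j\<close>, both taken without constant term.\<close>

definition sigma_conv :: "nat \<Rightarrow> nat \<Rightarrow> nat \<Rightarrow> int" where
  "sigma_conv i j n = (\<Sum>m\<in>{1..<n}. int (divsum i m) * int (divsum j (n - m)))"

text \<open>Put m = a x and n - m = b y: a divisor a of m and a divisor b of n - m determine x and
  y.\<close>

lemma sum_quads_powers:
  "(\<Sum>(a, b, x, y)\<in>quads n. int a ^ i * int b ^ j) = sigma_conv i j n"
proof -
  have "sigma_conv i j n = (\<Sum>m\<in>{1..<n}. \<Sum>(a, b)\<in>{d. d dvd m} \<times> {d. d dvd n - m}. int a ^ i * int b ^ j)"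
    by (simp add: sigma_conv_def divsum_def sum_product sum.cartesian_product)
  also have "\<dots> = (\<Sum>(m, a, b)\<in>(SIGMA m:{1..<n}. {d. d dvd m} \<times> {d. d dvd n - m}). int a ^ i * int b ^ j)"
    by (subst sum.Sigma) (auto simp: case_prod_unfold)
  also have "\<dots> = (\<Sum>(a, b, x, y)\<in>quads n. int a ^ i * int b ^ j)"
  proof (rule sum.reindex_bij_witness[where j = "\<lambda>(m, a, b). (a, b, m div a, (n - m) div b)"
        and i = "\<lambda>(a, b, x, y). (a * x, a, b)"])
    fix t assume "t \<in> (SIGMA m:{1..<n}. {d. d dvd m} \<times> {d. d dvd n - m})"
    then obtain m a b where t: "t = (m, a, b)" "1 \<le> m" "m < n" "a dvd m" "b dvd n - m" by auto
    have pos: "0 < a" "0 < b" using t by (auto intro!: Nat.gr0I)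
    have "0 < m div a" "0 < (n - m) div b" using t pos
      by (auto simp: div_greater_zero_iff dvd_imp_le)
    then show "(case t of (m, a, b) \<Rightarrow> (a, b, m div a, (n - m) div b)) \<in> quads n"
      using t pos by (auto simp: quads_def)
  qed (auto simp: quads_def)
  finally show ?thesis ..
qed

lemma sigma_conv_commute: "sigma_conv i j n = sigma_conv j i n"
proof -
  have "sigma_conv i j n = (\<Sum>(a, b, x, y)\<in>quads n. int b ^ i * int a ^ j)"
    using sum_quads_swap[where P = "\<lambda>_ _ _ _. True" and n = n and g = "\<lambda>a b x y. int a ^ i * int b ^ j"]
    by (simp add: sum_quads_powers[symmetric])
  also have "\<dots> = sigma_conv j i n" by (simp add: sum_quads_powers[symmetric] mult.commute)
  finally show ?thesis .
qed

lemma sum_quads_combination: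
  "(\<Sum>(a, b, x, y)\<in>quads n. k * (int a ^ i * int b ^ j)) = k * sigma_conv i j n"
  by (simp add: sum_quads_powers[symmetric] sum_distrib_left case_prod_unfold)

section \<open>Evaluation of three convolutions\<close>

lemma power_sums:
  fixes d :: nat
  defines "P \<equiv> \<lambda>k. \<Sum>a\<in>{1..<d}. int a ^ k" and "t \<equiv> int d"
  shows "2 * P 1 = t ^ 2 - t"
    and "6 * P 2 = 2 * t ^ 3 - 3 * t ^ 2 + t"
    and "4 * P 3 = t ^ 4 - 2 * t ^ 3 + t ^ 2"
    and "30 * P 4 = 6 * t ^ 5 - 15 * t ^ 4 + 10 * t ^ 3 - t"
    and "12 * P 5 = 2 * t ^ 6 - 6 * t ^ 5 + 5 * t ^ 4 - t ^ 2"
    and "42 * P 6 = 6 * t ^ 7 - 21 * t ^ 6 + 21 * t ^ 5 - 7 * t ^ 3 + t"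
proof -
  have step: "{1..<Suc e} = (if e = 0 then {} else insert e {1..<e})" for e by auto
  show "2 * P 1 = t ^ 2 - t" "6 * P 2 = 2 * t ^ 3 - 3 * t ^ 2 + t" "4 * P 3 = t ^ 4 - 2 * t ^ 3 + t ^ 2"
    "30 * P 4 = 6 * t ^ 5 - 15 * t ^ 4 + 10 * t ^ 3 - t"
    "12 * P 5 = 2 * t ^ 6 - 6 * t ^ 5 + 5 * t ^ 4 - t ^ 2"
    "42 * P 6 = 6 * t ^ 7 - 21 * t ^ 6 + 21 * t ^ 5 - 7 * t ^ 3 + t"
    unfolding P_def t_def
    by (induction d; simp add: step distrib_left; simp add: eval_nat_numeral algebra_simps)+
qed

text \<open>Since (n/d) d = n, the diagonal a = b contributes a factor n. It later becomes the
  derivative in Ramanujan's identities.\<close>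

lemma divisor_weight:
  assumes "(d::nat) dvd n" "0 < n"
  shows "(int (n div d) - 1) * int d ^ Suc k = int n * int d ^ k - int d ^ Suc k"
  using assms by (auto elim!: dvdE simp: algebra_simps)

lemma int_divsum: "int (divsum k n) = (\<Sum>d\<in>{d. d dvd n}. int d ^ k)"
  by (simp add: divsum_def)

text \<open>With s = a^2 + b^2 and p = a b, the difference in \<open>liouville_identity\<close> is
  (s + p)^2 - (s - p)^2 = 4 s p = 4 (a^3 b + a b^3), so a single convolution appears.\<close>

lemma sigma_conv_1_3:
  assumes "0 < n"
  shows "240 * sigma_conv 1 3 n
    = 21 * int (divsum 5 n) + (10 - 30 * int n) * int (divsum 3 n) - int (divsum 1 n)"
proof -
  let ?f = "\<lambda>x y :: int. (x ^ 2 + x * y + y ^ 2) ^ 2"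
  \<comment> \<open>The factor 30 clears the denominators of the power sums up to exponent
    4.\<close>
  have inner: "30 * (\<Sum>a\<in>{1..<d}. ?f (int a) (int d - int a))
      = 21 * int d ^ 5 - 30 * int d ^ 4 + 10 * int d ^ 3 - int d" if "0 < d" for d
  proof -
    let ?t = "int d" and ?P = "\<lambda>k. \<Sum>a\<in>{1..<d}. int a ^ k"
    have "?f (int a) (?t - int a) = ?t ^ 4 * int a ^ 0 - 2 * ?t ^ 3 * int a ^ 1
        + 3 * ?t ^ 2 * int a ^ 2 - 2 * ?t * int a ^ 3 + int a ^ 4" for a
      by (simp add: eval_nat_numeral algebra_simps)
    then have "(\<Sum>a\<in>{1..<d}. ?f (int a) (?t - int a))
      = ?t ^ 4 * ?P 0 - 2 * ?t ^ 3 * ?P 1 + 3 * ?t ^ 2 * ?P 2 - 2 * ?t * ?P 3 + ?P 4"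
      by (simp only: sum.distrib sum_subtractf sum_distrib_left)
    \<comment> \<open>The range {1..<d} has d - 1 elements only for positive d, hence the condition
      on d.\<close>
    moreover have "?P 0 = ?t - 1" using that by (simp add: of_nat_diff)
    ultimately show ?thesis using power_sums[of d] by algebra
  qed
  have "(\<Sum>(a, b, x, y)\<in>quads n. ?f (int a) (int b) - ?f (int a) (- int b))
    = (\<Sum>(a, b, x, y)\<in>quads n. 4 * (int a ^ 1 * int b ^ 3))
      + (\<Sum>(a, b, x, y)\<in>quads n. 4 * (int a ^ 3 * int b ^ 1))"
    unfolding sum.distrib[symmetric]
    by (intro sum.cong) (auto simp: algebra_simps power2_eq_square power3_eq_cube)
  then have "30 * (8 * sigma_conv 1 3 n) = 30 * (\<Sum>(a, b, x, y)\<in>quads n. ?f (int a) (int b) - ?f (int a) (- int b))"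
    unfolding sum_quads_combination by (simp add: sigma_conv_commute[of 3 "Suc 0"])
  also have "\<dots> = (\<Sum>d\<in>{d. d dvd n}. 30 * (\<Sum>a\<in>{1..<d}. ?f (int a) (int d - int a))
        - 30 * ((int (n div d) - 1) * ?f (int d) (- int d)))"
    by (subst liouville_identity[OF assms, of ?f])
       (simp_all add: algebra_simps eval_nat_numeral sum_distrib_left)
  also have "\<dots> = (\<Sum>d\<in>{d. d dvd n}. 21 * int d ^ 5 + (10 - 30 * int n) * int d ^ 3 - int d ^ 1)"
  proof (rule sum.cong)
    fix d assume "d \<in> {d. d dvd n}"
    then have d: "d dvd n" by simp
    then have "0 < d" using assms by (auto intro!: Nat.gr0I)
    have "(int (n div d) - 1) * ?f (int d) (- int d) = int n * int d ^ 3 - int d ^ 4"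
      using divisor_weight[OF d assms, of 3] by (simp add: eval_nat_numeral algebra_simps)
    then show "30 * (\<Sum>a\<in>{1..<d}. ?f (int a) (int d - int a))
        - 30 * ((int (n div d) - 1) * ?f (int d) (- int d))
      = 21 * int d ^ 5 + (10 - 30 * int n) * int d ^ 3 - int d ^ 1"
      unfolding inner[OF \<open>0 < d\<close>] by (simp add: algebra_simps)
  qed simp
  finally show ?thesis
    by (simp only: int_divsum sum.distrib sum_subtractf sum_distrib_left)
qed

text \<open>The chosen function vanishes at (d, - d), so the diagonal a = b contributes nothing and
  no factor n arises.\<close>

lemma sigma_conv_3_3:
  assumes "0 < n"
  shows "120 * sigma_conv 3 3 n = int (divsum 7 n) - int (divsum 3 n)"
proof -
  let ?f = "\<lambda>x y :: int. x ^ 2 * y ^ 2 * (x + y) ^ 2"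
  have inner: "30 * (\<Sum>a\<in>{1..<d}. ?f (int a) (int d - int a)) = int d ^ 7 - int d ^ 3" for d
  proof -
    let ?t = "int d" and ?P = "\<lambda>k. \<Sum>a\<in>{1..<d}. int a ^ k"
    have "?f (int a) (?t - int a) = ?t ^ 4 * int a ^ 2 - 2 * ?t ^ 3 * int a ^ 3 + ?t ^ 2 * int a ^ 4" for a
      by (simp add: eval_nat_numeral algebra_simps)
    then have "(\<Sum>a\<in>{1..<d}. ?f (int a) (?t - int a))
      = ?t ^ 4 * ?P 2 - 2 * ?t ^ 3 * ?P 3 + ?t ^ 2 * ?P 4"
      by (simp only: sum.distrib sum_subtractf sum_distrib_left)
    then show ?thesis using power_sums[of d] by algebra
  qed
  have "?f (int a) (int b) - ?f (int a) (- int b) = 4 * (int a ^ 3 * int b ^ 3)" for a b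
    by (simp add: eval_nat_numeral algebra_simps)
  then have "30 * (4 * sigma_conv 3 3 n)
      = 30 * (\<Sum>(a, b, x, y)\<in>quads n. ?f (int a) (int b) - ?f (int a) (- int b))"
    by (simp only: sum_quads_combination)
  also have "\<dots> = (\<Sum>d\<in>{d. d dvd n}. 30 * (\<Sum>a\<in>{1..<d}. ?f (int a) (int d - int a)))"
    by (subst liouville_identity[OF assms, of ?f])
       (simp_all add: algebra_simps eval_nat_numeral sum_distrib_left)
  finally show ?thesis
    unfolding inner by (simp add: int_divsum sum_subtractf)
qed

text \<open>With s = a^2 + b^2 and p = a b, (s + p)^3 - (s - p)^3 = 6 (a^5 b + a b^5) + 14 a^3 b^3.
  The last term is removed by \<open>sigma_conv_3_3\<close>.\<close>

lemma sigma_conv_1_5: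
  assumes "0 < n"
  shows "504 * sigma_conv 1 5 n
    = 20 * int (divsum 7 n) + (21 - 42 * int n) * int (divsum 5 n) + int (divsum 1 n)"
proof -
  let ?f = "\<lambda>x y :: int. (x ^ 2 + x * y + y ^ 2) ^ 3"
  have inner: "420 * (\<Sum>a\<in>{1..<d}. ?f (int a) (int d - int a))
      = 249 * int d ^ 7 - 420 * int d ^ 6 + 210 * int d ^ 5 - 49 * int d ^ 3 + 10 * int d" if "0 < d" for d
  proof -
    let ?t = "int d" and ?P = "\<lambda>k. \<Sum>a\<in>{1..<d}. int a ^ k"
    have "?f (int a) (?t - int a) = ?t ^ 6 * int a ^ 0 - 3 * ?t ^ 5 * int a ^ 1
        + 6 * ?t ^ 4 * int a ^ 2 - 7 * ?t ^ 3 * int a ^ 3 + 6 * ?t ^ 2 * int a ^ 4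
        - 3 * ?t * int a ^ 5 + int a ^ 6" for a
      by (simp add: eval_nat_numeral algebra_simps)
    then have "(\<Sum>a\<in>{1..<d}. ?f (int a) (?t - int a))
      = ?t ^ 6 * ?P 0 - 3 * ?t ^ 5 * ?P 1 + 6 * ?t ^ 4 * ?P 2 - 7 * ?t ^ 3 * ?P 3
        + 6 * ?t ^ 2 * ?P 4 - 3 * ?t * ?P 5 + ?P 6"
      by (simp only: sum.distrib sum_subtractf sum_distrib_left)
    moreover have "?P 0 = ?t - 1" using that by (simp add: of_nat_diff)
    ultimately show ?thesis using power_sums[of d] by algebra
  qed
  have "(\<Sum>(a, b, x, y)\<in>quads n. ?f (int a) (int b) - ?f (int a) (- int b))
    = (\<Sum>(a, b, x, y)\<in>quads n. 6 * (int a ^ 1 * int b ^ 5))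
      + (\<Sum>(a, b, x, y)\<in>quads n. 6 * (int a ^ 5 * int b ^ 1))
      + (\<Sum>(a, b, x, y)\<in>quads n. 14 * (int a ^ 3 * int b ^ 3))"
    unfolding sum.distrib[symmetric]
    by (intro sum.cong) (auto simp: algebra_simps eval_nat_numeral)
  then have "420 * (12 * sigma_conv 1 5 n + 14 * sigma_conv 3 3 n)
      = 420 * (\<Sum>(a, b, x, y)\<in>quads n. ?f (int a) (int b) - ?f (int a) (- int b))"
    unfolding sum_quads_combination by (simp add: sigma_conv_commute[of 5 "Suc 0"])
  also have "\<dots> = (\<Sum>d\<in>{d. d dvd n}. 420 * (\<Sum>a\<in>{1..<d}. ?f (int a) (int d - int a))
        - 420 * ((int (n div d) - 1) * ?f (int d) (- int d)))"
    by (subst liouville_identity[OF assms, of ?f])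
       (simp_all add: algebra_simps eval_nat_numeral sum_distrib_left)
  also have "\<dots> = (\<Sum>d\<in>{d. d dvd n}. 249 * int d ^ 7 + (210 - 420 * int n) * int d ^ 5
      - 49 * int d ^ 3 + 10 * int d ^ 1)"
  proof (rule sum.cong)
    fix d assume "d \<in> {d. d dvd n}"
    then have d: "d dvd n" by simp
    then have "0 < d" using assms by (auto intro!: Nat.gr0I)
    have "(int (n div d) - 1) * ?f (int d) (- int d) = int n * int d ^ 5 - int d ^ 6"
      using divisor_weight[OF d assms, of 5] by (simp add: eval_nat_numeral algebra_simps)
    then show "420 * (\<Sum>a\<in>{1..<d}. ?f (int a) (int d - int a))
        - 420 * ((int (n div d) - 1) * ?f (int d) (- int d))
      = 249 * int d ^ 7 + (210 - 420 * int n) * int d ^ 5 - 49 * int d ^ 3 + 10 * int d ^ 1"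
      unfolding inner[OF \<open>0 < d\<close>] by (simp add: algebra_simps)
  qed simp
  finally have "420 * (12 * sigma_conv 1 5 n + 14 * sigma_conv 3 3 n)
    = 249 * int (divsum 7 n) + (210 - 420 * int n) * int (divsum 5 n)
      - 49 * int (divsum 3 n) + 10 * int (divsum 1 n)"
    by (simp only: int_divsum sum.distrib sum_subtractf sum_distrib_left)
  with sigma_conv_3_3[OF assms] show ?thesis by (simp add: algebra_simps)
qed

section \<open>Ramanujan's identities\<close>

definition eis_fps :: "nat \<Rightarrow> complex \<Rightarrow> complex fps" where
  "eis_fps k c = Abs_fps (\<lambda>n. if n = 0 then 1 else c * of_nat (divsum (k - 1) n))"

lemma divsum_le: "0 < n \<Longrightarrow> divsum k n \<le> n ^ Suc k"
proof -
  assume n: "0 < n"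
  have "divsum k n \<le> (\<Sum>d\<in>{d. d dvd n}. n ^ k)"
    unfolding divsum_def using n by (intro sum_mono power_mono) (auto dest: dvd_imp_le)
  also have "\<dots> = card {d. d dvd n} * n ^ k" by simp
  also have "card {d. d dvd n} \<le> card {1..n}"
    using n by (intro card_mono) (auto dest: dvd_imp_le intro!: Nat.gr0I simp: Suc_le_eq)
  finally show "divsum k n \<le> n ^ Suc k" by simp
qed

lemma conv_radius_power: "conv_radius (\<lambda>n. of_nat n ^ k :: complex) = 1"
proof (rule conv_radius_ratio_limit_nonzero[where c = 1])
  show "(\<lambda>n. cmod (of_nat n ^ k) / cmod (of_nat (Suc n) ^ k)) \<longlonglongrightarrow> 1"
    unfolding norm_power norm_of_nat power_divide[symmetric]
    by (rule tendsto_eq_intros, real_asymp) simp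
qed (simp_all add: one_ereal_def)

lemma eis_fps_conv_radius: "fps_conv_radius (eis_fps k c) \<ge> 1"
  unfolding fps_conv_radius_def
proof (rule conv_radius_geI_ex')
  fix r :: real assume r: "0 < r" "ereal r < 1"
  define R where "R = complex_of_real r"
  have "summable (\<lambda>n. norm (of_nat n ^ Suc (k - 1) * R ^ n :: complex))"
    using r by (intro abs_summable_in_conv_radius, subst conv_radius_power) (auto simp: R_def)
  then have S: "summable (\<lambda>n. norm c * norm (of_nat n ^ Suc (k - 1) * R ^ n :: complex))"
    by (rule summable_mult)
  have "summable (\<lambda>n. fps_nth (eis_fps k c) n * R ^ n)"
  \<comment> \<open>The comparison starts at n = 1: at n = 0 the coefficient is 1 while the bound is
    0.\<close>
  proof (rule summable_comparison_test'[OF S, of 1])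
    fix n :: nat assume "1 \<le> n"
    then have "real (divsum (k - 1) n) \<le> real n ^ Suc (k - 1)"
      using divsum_le[of n "k - 1"] by (metis of_nat_le_iff of_nat_power Suc_le_eq One_nat_def)
    then have "real (divsum (k - 1) n) * norm R ^ n \<le> real n ^ Suc (k - 1) * norm R ^ n"
      by (rule mult_right_mono) simp
    from mult_left_mono[OF this, of "norm c"]
    show "norm (fps_nth (eis_fps k c) n * R ^ n)
      \<le> norm c * norm (of_nat n ^ Suc (k - 1) * R ^ n :: complex)"
      using \<open>1 \<le> n\<close> by (simp add: eis_fps_def norm_mult norm_power mult.assoc)
  qed
  then show "summable (\<lambda>n. fps_nth (eis_fps k c) n * complex_of_real r ^ n)" by (simp add: R_def)
qed

lemma norm_lt_eis_fps: "norm z < 1 \<Longrightarrow> ereal (norm z) < fps_conv_radius (eis_fps k c)"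
  using eis_fps_conv_radius[of k c] by (metis ereal_less(3) less_le_trans)

lemma norm_qq_less_1: "z \<in> uhp \<Longrightarrow> norm (qq z) < 1"
  by (simp add: qq_def uhp_def)

lemma open_uhp: "open uhp" unfolding uhp_def by (rule open_halfspace_Im_gt)

lemma Eis_eq_eval_fps:
  assumes "z \<in> uhp"
  shows "Eis k c z = eval_fps (eis_fps k c) (qq z)"
proof -
  let ?q = "qq z" and ?F = "fps_nth (eis_fps k c)"
  have F: "summable (\<lambda>n. ?F n * ?q ^ n)"
    using norm_lt_eis_fps[OF norm_qq_less_1[OF assms]] by (rule summable_fps)
  have "eval_fps (eis_fps k c) ?q = 1 + (\<Sum>n. ?F (Suc n) * ?q ^ Suc n)"
    unfolding eval_fps_def using suminf_split_head[OF F] by (simp add: eis_fps_def)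
  also have "(\<Sum>n. ?F (Suc n) * ?q ^ Suc n) = (\<Sum>n. c * (of_nat (divsum (k - 1) (Suc n)) * ?q ^ Suc n))"
    by (simp add: eis_fps_def mult.assoc)
  also have "\<dots> = c * (\<Sum>n. of_nat (divsum (k - 1) (Suc n)) * ?q ^ Suc n)"
  \<comment> \<open>Summability without the factor \<open>c\<close> is obtained by dividing by
    \<open>c\<close>. For c = 0 both sides are 0.\<close>
  proof (cases "c = 0")
    case False
    have "summable (\<lambda>n. c * (of_nat (divsum (k - 1) (Suc n)) * ?q ^ Suc n))"
      using F[THEN summable_ignore_initial_segment, of 1] by (simp add: eis_fps_def mult.assoc)
    then have "summable (\<lambda>n. of_nat (divsum (k - 1) (Suc n)) * ?q ^ Suc n)"
      using False by (simp add: summable_cmult_iff)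
    then show ?thesis by (rule suminf_mult)
  qed simp
  finally show ?thesis by (simp add: Eis_def)
qed

text \<open>Since dq/dz = 2 pi i q, the normalised derivative acts on q-expansions as q d/dq, that
  is, as \<open>fps_X * fps_deriv\<close>.\<close>

lemma Eis_has_derivative:
  assumes z: "z \<in> uhp"
  shows "(Eis k c has_field_derivative
    2 * pi * \<i> * eval_fps (fps_X * fps_deriv (eis_fps k c)) (qq z)) (at z)"
proof -
  let ?F = "eis_fps k c"
  have n: "ereal (norm (qq z)) < fps_conv_radius ?F"
    using norm_lt_eis_fps[OF norm_qq_less_1[OF z]] .
  have n': "ereal (norm (qq z)) < fps_conv_radius (fps_deriv ?F)"
    using n fps_conv_radius_deriv[of ?F] by (rule less_le_trans)
  have q: "(qq has_field_derivative 2 * pi * \<i> * qq z) (at z)"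
    unfolding qq_def by (auto intro!: derivative_eq_intros)
  have "((\<lambda>z. eval_fps ?F (qq z)) has_field_derivative
      eval_fps (fps_deriv ?F) (qq z) * (2 * pi * \<i> * qq z)) (at z)"
    by (rule DERIV_chain2[OF has_field_derivative_eval_fps[OF n] q])
  then have "(Eis k c has_field_derivative
      eval_fps (fps_deriv ?F) (qq z) * (2 * pi * \<i> * qq z)) (at z)"
    by (rule has_field_derivative_transform_within_open[OF _ open_uhp z]) (simp add: Eis_eq_eval_fps)
  moreover have "eval_fps (fps_X * fps_deriv ?F) (qq z) = qq z * eval_fps (fps_deriv ?F) (qq z)"
    by (subst eval_fps_mult) (use n' in auto)
  ultimately show ?thesis by (simp add: mult_ac)
qed

lemma holomorphic_Eis: "Eis k c holomorphic_on uhp"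
  using Eis_has_derivative by (auto simp: holomorphic_on_open[OF open_uhp])

lemma eis_fps_mult_nth:
  assumes "0 < n"
  shows "fps_nth (eis_fps k c * eis_fps l d) n
    = c * of_nat (divsum (k - 1) n) + d * of_nat (divsum (l - 1) n)
      + c * d * of_int (sigma_conv (k - 1) (l - 1) n)"
proof -
  have "{0..n} = insert 0 (insert n {1..<n})" using assms by auto
  then have "fps_nth (eis_fps k c * eis_fps l d) n
    = c * of_nat (divsum (k - 1) n) + d * of_nat (divsum (l - 1) n)
      + (\<Sum>m\<in>{1..<n}. c * of_nat (divsum (k - 1) m) * (d * of_nat (divsum (l - 1) (n - m))))"
    using assms by (simp add: fps_mult_nth eis_fps_def)
  also have "(\<Sum>m\<in>{1..<n}. c * of_nat (divsum (k - 1) m) * (d * of_nat (divsum (l - 1) (n - m))))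
      = c * d * of_int (sigma_conv (k - 1) (l - 1) n)"
    by (simp add: sigma_conv_def sum_distrib_left mult_ac)
  finally show ?thesis .
qed

text \<open>The constant terms cancel, and for n > 0 the coefficient identity is -24 times
  \<open>sigma_conv_1_3\<close>.\<close>

lemma eis_fps_ramanujan_4:
  "3 * (fps_X * fps_deriv (eis_fps 4 240)) = eis_fps 2 (-24) * eis_fps 4 240 - eis_fps 6 (-504)"
proof (rule fps_ext)
  fix n
  show "fps_nth (3 * (fps_X * fps_deriv (eis_fps 4 240))) n
    = fps_nth (eis_fps 2 (-24) * eis_fps 4 240 - eis_fps 6 (-504)) n"
  proof (cases "n = 0")
    case True
    then show ?thesis by (simp add: eis_fps_def fps_mult_nth)
  next
    case False
    have "(of_int (240 * sigma_conv 1 3 n) :: complex)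
      = of_int (21 * int (divsum 5 n) + (10 - 30 * int n) * int (divsum 3 n) - int (divsum 1 n))"
      using sigma_conv_1_3[of n] False by simp
    then have "240 * of_int (sigma_conv 1 3 n) = 21 * of_nat (divsum 5 n)
        + (10 - 30 * of_nat n) * of_nat (divsum 3 n) - (of_nat (divsum 1 n) :: complex)"
      by simp
    moreover have "fps_nth (3 * (fps_X * fps_deriv (eis_fps 4 240))) n = 3 * of_nat n * (240 * of_nat (divsum 3 n))"
      using False by (simp add: eis_fps_def numeral_fps_const algebra_simps)
    moreover have "fps_nth (eis_fps 2 (-24) * eis_fps 4 240 - eis_fps 6 (-504)) n
      = -24 * of_nat (divsum 1 n) + 240 * of_nat (divsum 3 n) - 24 * 240 * of_int (sigma_conv 1 3 n)
        + 504 * of_nat (divsum 5 n)"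
      using False by (subst fps_sub_nth, subst eis_fps_mult_nth) (simp_all add: eis_fps_def)
    ultimately show ?thesis by algebra
  qed
qed

text \<open>For n > 0 this is 24 times \<open>sigma_conv_1_5\<close> minus 480 times
  \<open>sigma_conv_3_3\<close>; the terms with \<open>divsum 7\<close> cancel.\<close>

lemma eis_fps_ramanujan_6:
  "2 * (fps_X * fps_deriv (eis_fps 6 (-504))) = eis_fps 2 (-24) * eis_fps 6 (-504) - eis_fps 4 240 ^ 2"
proof (rule fps_ext)
  fix n
  show "fps_nth (2 * (fps_X * fps_deriv (eis_fps 6 (-504)))) n
    = fps_nth (eis_fps 2 (-24) * eis_fps 6 (-504) - eis_fps 4 240 ^ 2) n"
  proof (cases "n = 0")
    case True
    then show ?thesis by (simp add: eis_fps_def fps_mult_nth power2_eq_square)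
  next
    case False
    have "(of_int (504 * sigma_conv 1 5 n) :: complex)
      = of_int (20 * int (divsum 7 n) + (21 - 42 * int n) * int (divsum 5 n) + int (divsum 1 n))"
      using sigma_conv_1_5[of n] False by simp
    then have "504 * of_int (sigma_conv 1 5 n) = 20 * of_nat (divsum 7 n)
        + (21 - 42 * of_nat n) * of_nat (divsum 5 n) + (of_nat (divsum 1 n) :: complex)"
      by simp
    moreover have "(of_int (120 * sigma_conv 3 3 n) :: complex)
      = of_int (int (divsum 7 n) - int (divsum 3 n))"
      using sigma_conv_3_3[of n] False by simp
    then have "120 * of_int (sigma_conv 3 3 n) = of_nat (divsum 7 n) - (of_nat (divsum 3 n) :: complex)"
      by simp
    moreover have "fps_nth (2 * (fps_X * fps_deriv (eis_fps 6 (-504)))) n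
        = - 2 * of_nat n * (504 * of_nat (divsum 5 n))"
      using False by (simp add: eis_fps_def numeral_fps_const algebra_simps)
    moreover have "fps_nth (eis_fps 2 (-24) * eis_fps 6 (-504) - eis_fps 4 240 ^ 2) n
      = -24 * of_nat (divsum 1 n) - 504 * of_nat (divsum 5 n) + 24 * 504 * of_int (sigma_conv 1 5 n)
        - (2 * 240 * of_nat (divsum 3 n) + 240 * 240 * of_int (sigma_conv 3 3 n))"
      unfolding power2_eq_square using False
      by (subst fps_sub_nth, subst eis_fps_mult_nth, simp, subst eis_fps_mult_nth) (simp_all add: eis_fps_def)
    ultimately show ?thesis by algebra
  qed
qed

lemma eval_eis_fps_mult:
  assumes "z \<in> uhp"
  shows "eval_fps (eis_fps k c * eis_fps l d) (qq z) = Eis k c z * Eis l d z"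
  using norm_lt_eis_fps[OF norm_qq_less_1[OF assms]] assms by (simp add: eval_fps_mult Eis_eq_eval_fps)

lemma conv_radius_eis_fps_mult: "fps_conv_radius (eis_fps k c * eis_fps l d) \<ge> 1"
  using fps_conv_radius_mult[of "eis_fps k c" "eis_fps l d"] eis_fps_conv_radius
  by (metis min.bounded_iff order_trans)

lemma norm_lt_eis_fps_mult:
  "norm z < 1 \<Longrightarrow> ereal (norm z) < fps_conv_radius (eis_fps k c * eis_fps l d)"
  using conv_radius_eis_fps_mult[of k c l d] by (metis ereal_less(3) less_le_trans)

lemma eval_eis_fps_deriv:
  assumes "z \<in> uhp" "numeral w * (fps_X * fps_deriv (eis_fps k c)) = G"
  shows "eval_fps (fps_X * fps_deriv (eis_fps k c)) (qq z) = eval_fps G (qq z) / numeral w"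
proof -
  have "1 \<le> fps_conv_radius (fps_deriv (eis_fps k c))"
    using fps_conv_radius_deriv[of "eis_fps k c"] eis_fps_conv_radius[of k c] by (rule order_trans[rotated])
  then have "1 \<le> fps_conv_radius (fps_X * fps_deriv (eis_fps k c))"
    using fps_conv_radius_mult[of fps_X "fps_deriv (eis_fps k c)"] by (simp add: min_def order_trans split: if_splits)
  then have "ereal (norm (qq z)) < fps_conv_radius (fps_X * fps_deriv (eis_fps k c))"
    using norm_qq_less_1[OF assms(1)] by (metis ereal_less(3) less_le_trans)
  then show ?thesis unfolding assms(2)[symmetric]
    by (subst (2) eval_fps_mult) simp_all
qed

lemma ramanujan_E4:
  assumes "z \<in> uhp"
  shows "(E4 has_field_derivative 2 * pi * \<i> * ((E2 z * E4 z - E6 z) / 3)) (at z)"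
proof -
  let ?q = "qq z"
  have "eval_fps (fps_X * fps_deriv (eis_fps 4 240)) ?q
    = eval_fps (eis_fps 2 (-24) * eis_fps 4 240 - eis_fps 6 (-504)) ?q / 3"
    by (rule eval_eis_fps_deriv[OF assms eis_fps_ramanujan_4])
  also have "eval_fps (eis_fps 2 (-24) * eis_fps 4 240 - eis_fps 6 (-504)) ?q = E2 z * E4 z - E6 z"
    using norm_lt_eis_fps norm_lt_eis_fps_mult norm_qq_less_1[OF assms] assms
    by (subst eval_fps_diff) (auto simp: eval_eis_fps_mult E2_def E4_def E6_def Eis_eq_eval_fps)
  finally show ?thesis using Eis_has_derivative[OF assms, of 4 240] by (simp only: E4_def)
qed

lemma ramanujan_E6:
  assumes "z \<in> uhp"
  shows "(E6 has_field_derivative 2 * pi * \<i> * ((E2 z * E6 z - E4 z ^ 2) / 2)) (at z)"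
proof -
  let ?q = "qq z"
  have "eval_fps (fps_X * fps_deriv (eis_fps 6 (-504))) ?q
    = eval_fps (eis_fps 2 (-24) * eis_fps 6 (-504) - eis_fps 4 240 ^ 2) ?q / 2"
    by (rule eval_eis_fps_deriv[OF assms eis_fps_ramanujan_6])
  also have "eval_fps (eis_fps 2 (-24) * eis_fps 6 (-504) - eis_fps 4 240 ^ 2) ?q = E2 z * E6 z - E4 z ^ 2"
    using norm_lt_eis_fps_mult norm_qq_less_1[OF assms] assms unfolding power2_eq_square
    by (subst eval_fps_diff) (auto simp: eval_eis_fps_mult E2_def E4_def E6_def)
  finally show ?thesis using Eis_has_derivative[OF assms, of 6 "-504"] by (simp only: E6_def)
qed

section \<open>The operators and their commutators\<close>

lemma zero_in_Hsp: "(\<lambda>n z. 0) \<in> Hsp"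
  by (simp add: Hsp_def)

lemma Hsp_holomorphic: "h \<in> Hsp \<Longrightarrow> h n holomorphic_on uhp"
  by (simp add: Hsp_def)

lemma Hsp_outside: "h \<in> Hsp \<Longrightarrow> z \<notin> uhp \<Longrightarrow> h n z = 0"
  by (simp add: Hsp_def)

lemma Hsp_comb:
  assumes "h \<in> Hsp" "g \<in> Hsp"
  shows "(\<lambda>n z. c * h n z + g n z) \<in> Hsp"
proof -
  have "finite {n. (\<lambda>z. c * h n z + g n z) \<noteq> (\<lambda>z. 0)}"
    by (rule finite_subset[of _ "{n. h n \<noteq> (\<lambda>z. 0)} \<union> {n. g n \<noteq> (\<lambda>z. 0)}"])
      (use assms in \<open>auto simp: Hsp_def\<close>)
  then show ?thesis using assms by (auto simp: Hsp_def intro!: holomorphic_intros)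
qed

text \<open>One criterion for all degree-raising operators: the support in the grading is translated
  by d, hence stays finite.\<close>

lemma Hsp_shift:
  assumes h: "h \<in> Hsp" and \<Phi>0: "\<And>m. \<Phi> m (\<lambda>z. 0) = (\<lambda>z. 0)"
    and hol: "\<And>m f. f holomorphic_on uhp \<Longrightarrow> \<Phi> m f holomorphic_on uhp"
    and out: "\<And>m z. z \<notin> uhp \<Longrightarrow> \<Phi> m (h (m - d)) z = 0"
  shows "(\<lambda>m. \<Phi> m (h (m - d))) \<in> Hsp"
proof -
  have "{m. \<Phi> m (h (m - d)) \<noteq> (\<lambda>z. 0)} \<subseteq> (\<lambda>n. n + d) ` {n. h n \<noteq> (\<lambda>z. 0)}"
  proof
    fix m assume "m \<in> {m. \<Phi> m (h (m - d)) \<noteq> (\<lambda>z. 0)}"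
    then have "h (m - d) \<noteq> (\<lambda>z. 0)" using \<Phi>0 by auto
    then show "m \<in> (\<lambda>n. n + d) ` {n. h n \<noteq> (\<lambda>z. 0)}"
      by (intro image_eqI[of _ _ "m - d"]) auto
  qed
  then have "finite {m. \<Phi> m (h (m - d)) \<noteq> (\<lambda>z. 0)}"
    using h by (auto simp: Hsp_def intro: finite_subset)
  then show ?thesis using hol out Hsp_holomorphic[OF h] by (auto simp: Hsp_def)
qed

lemma Dk_holomorphic: "f holomorphic_on uhp \<Longrightarrow> Dk k f holomorphic_on uhp"
  unfolding Dk_def E2_def by (auto intro!: holomorphic_intros holomorphic_deriv open_uhp holomorphic_Eis)

lemma delta_in_Hsp: "delta h \<in> Hsp"
proof (cases "h \<in> Hsp")
  case True
  have "(\<lambda>m z. if z \<in> uhp then Dk (m - 2) (h (m - 2)) z else 0) \<in> Hsp"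
  proof (rule Hsp_shift[OF True, where \<Phi> = "\<lambda>m f z. if z \<in> uhp then Dk (m - 2) f z else 0"])
    show "(\<lambda>z. if z \<in> uhp then Dk (m - 2) f z else 0) holomorphic_on uhp"
      if "f holomorphic_on uhp" for m f
      using Dk_holomorphic[OF that] by (rule holomorphic_transform) simp
  qed (auto simp: Dk_def)
  then show ?thesis by (simp add: delta_def True)
qed (simp add: delta_def zero_in_Hsp)

lemma e4_in_Hsp: "e4 h \<in> Hsp"
proof (cases "h \<in> Hsp")
  case True
  have "(\<lambda>m z. E4 z * h (m - 4) z) \<in> Hsp"
    by (rule Hsp_shift[OF True, where \<Phi> = "\<lambda>m f z. E4 z * f z"])
      (auto simp: Hsp_outside[OF True] E4_def intro!: holomorphic_intros holomorphic_Eis)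
  then show ?thesis by (simp add: e4_def True)
qed (simp add: e4_def zero_in_Hsp)

lemma e6_in_Hsp: "e6 h \<in> Hsp"
proof (cases "h \<in> Hsp")
  case True
  have "(\<lambda>m z. E6 z * h (m - 6) z) \<in> Hsp"
    by (rule Hsp_shift[OF True, where \<Phi> = "\<lambda>m f z. E6 z * f z"])
      (auto simp: Hsp_outside[OF True] E6_def intro!: holomorphic_intros holomorphic_Eis)
  then show ?thesis by (simp add: e6_def True)
qed (simp add: e6_def zero_in_Hsp)

lemma Hsp_differentiable: "h \<in> Hsp \<Longrightarrow> z \<in> uhp \<Longrightarrow> h n field_differentiable at z"
  using Hsp_holomorphic open_uhp by (auto simp: holomorphic_on_open field_differentiable_def)

lemma Dk_comb:
  assumes "f field_differentiable at z" "g field_differentiable at z"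
  shows "Dk k (\<lambda>z. c * f z + g z) z = c * Dk k f z + Dk k g z"
proof -
  have d: "deriv (\<lambda>z. c * f z + g z) z = c * deriv f z + deriv g z"
    using assms by (simp add: field_differentiable_mult)
  have "(c * a + b) / p - K * e * (c * u + v) = c * (a / p - K * e * u) + (b / p - K * e * v)"
    for a b p K e u v :: complex
    by (simp add: algebra_simps add_divide_distrib)
  then show ?thesis unfolding Dk_def d .
qed

text \<open>The Leibniz rule, with the weight k split into k - l for F and l for f. As G is the
  normalised derivative of F, the factor in front of f is the derivative of F in weight k -
  l.\<close>

lemma Dk_mult:
  assumes F: "(F has_field_derivative 2 * pi * \<i> * G) (at z)" and f: "f field_differentiable at z"
  shows "Dk k (\<lambda>z. F z * f z) z
    = F z * Dk l f z + (G - complex_of_real (k - l) / 12 * E2 z * F z) * f z"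
proof -
  have d: "deriv (\<lambda>z. F z * f z) z = F z * deriv f z + 2 * pi * \<i> * G * f z"
    using DERIV_mult'[OF F field_differentiable_derivI[OF f]] by (rule DERIV_imp_deriv)
  have "(u * a + p * b * v) / p - K / 12 * e * (u * v)
      = u * (a / p - L / 12 * e * v) + (b - (K - L) / 12 * e * u) * v"
    if "p \<noteq> 0" for a b p K L e u v :: complex
    using that by (simp add: field_simps)
  then show ?thesis unfolding Dk_def d by simp
qed

lemma gen_op_comb:
  assumes h: "h \<in> Hsp" and g: "g \<in> Hsp"
  shows "gen_op a (\<lambda>n z. c * h n z + g n z) = (\<lambda>n z. c * gen_op a h n z + gen_op a g n z)"
proof (cases a)
  case Gd
  then show ?thesis
    using h g Hsp_comb[OF h g] Hsp_differentiable[OF h] Hsp_differentiable[OF g]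
    by (simp add: delta_def fun_eq_iff Dk_comb)
qed (use h g Hsp_comb[OF h g] in \<open>auto simp: e4_def e6_def fun_eq_iff algebra_simps\<close>)

lemma gen_op_zero: "gen_op a (\<lambda>n z. 0) = (\<lambda>n z. 0)"
  \<comment> \<open>For an operator T this reads T 0 = - T 0 + T 0 = 0.\<close>
  using gen_op_comb[OF zero_in_Hsp zero_in_Hsp, of a "-1"] by simp

lemma e6_e4: "e6 (e4 h) = e4 (e6 h)"
proof (cases "h \<in> Hsp")
  case True
  then show ?thesis using e4_in_Hsp[of h] e6_in_Hsp[of h]
    by (simp add: e4_def e6_def fun_eq_iff diff_diff_eq)
next
  case False
  then show ?thesis by (simp add: e4_def e6_def zero_in_Hsp)
qed

text \<open>In the Leibniz rule with weight difference 4, the term E2 E4 / 3 of Ramanujan's identity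
  cancels and only - E6 / 3 is left.\<close>

lemma e4_delta:
  assumes h: "h \<in> Hsp"
  shows "e4 (delta h) = (\<lambda>n z. 1 / 3 * e6 h n z + delta (e4 h) n z)"
proof (intro ext)
  fix n z
  show "e4 (delta h) n z = 1 / 3 * e6 h n z + delta (e4 h) n z"
  proof (cases "z \<in> uhp")
    case z: True
    have "Dk (n - 2) (\<lambda>z. E4 z * h (n - 6) z) z = E4 z * Dk (n - 6) (h (n - 6)) z - E6 z * h (n - 6) z / 3"
      by (subst Dk_mult[OF ramanujan_E4[OF z] Hsp_differentiable[OF h z], where l = "n - 6"])
        (simp add: algebra_simps diff_divide_distrib)
    then show ?thesis using z h e4_in_Hsp[of h] delta_in_Hsp[of h]
      by (simp add: e4_def e6_def delta_def diff_diff_eq)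
  next
    case False
    then show ?thesis
      using Hsp_outside[OF e4_in_Hsp] Hsp_outside[OF e6_in_Hsp] Hsp_outside[OF delta_in_Hsp] by simp
  qed
qed

text \<open>Here the weight difference is 6, so E2 E6 / 2 cancels and - E4^2 / 2 is left.\<close>

lemma e6_delta:
  assumes h: "h \<in> Hsp"
  shows "e6 (delta h) = (\<lambda>n z. 1 / 2 * e4 (e4 h) n z + delta (e6 h) n z)"
proof (intro ext)
  fix n z
  show "e6 (delta h) n z = 1 / 2 * e4 (e4 h) n z + delta (e6 h) n z"
  proof (cases "z \<in> uhp")
    case z: True
    have "Dk (n - 2) (\<lambda>z. E6 z * h (n - 8) z) z = E6 z * Dk (n - 8) (h (n - 8)) z - E4 z * (E4 z * h (n - 8) z) / 2"
      by (subst Dk_mult[OF ramanujan_E6[OF z] Hsp_differentiable[OF h z], where l = "n - 8"])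
        (simp add: algebra_simps diff_divide_distrib power2_eq_square)
    then show ?thesis using z h e4_in_Hsp[of h] e6_in_Hsp[of h] delta_in_Hsp[of h]
      by (simp add: e4_def e6_def delta_def diff_diff_eq)
  next
    case False
    then show ?thesis
      using Hsp_outside[OF e4_in_Hsp] Hsp_outside[OF e6_in_Hsp] Hsp_outside[OF delta_in_Hsp] by simp
  qed
qed

section \<open>Spanning\<close>

text \<open>The linear span, built by adding one multiple at a time, so that closure properties
  follow by induction without handling index sets and coefficients.\<close>

inductive_set opspan :: "op set \<Rightarrow> op set" for A where
  opspan_zero: "(\<lambda>h n z. 0) \<in> opspan A"
| opspan_step: "T \<in> A \<Longrightarrow> U \<in> opspan A \<Longrightarrow> (\<lambda>h n z. c * T h n z + U h n z) \<in> opspan A"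

lemma opspan_base: "T \<in> A \<Longrightarrow> T \<in> opspan A"
  using opspan_step[OF _ opspan_zero, of T A 1] by simp

lemma opspan_comb:
  assumes "T \<in> opspan A" "U \<in> opspan A"
  shows "(\<lambda>h n z. c * T h n z + U h n z) \<in> opspan A"
  using assms(1)
proof induction
  case opspan_zero
  then show ?case using assms(2) by simp
next
  case (opspan_step T V b)
  show ?case
    using opspan.opspan_step[OF opspan_step.hyps(1) opspan_step.IH, of "c * b"] by (simp add: algebra_simps)
qed

lemma opspan_mono: "A \<subseteq> B \<Longrightarrow> T \<in> opspan A \<Longrightarrow> T \<in> opspan B"
proof -
  assume AB: "A \<subseteq> B" and "T \<in> opspan A"
  from this(2) show ?thesis
    by induction (use AB in \<open>blast intro: opspan.intros\<close>)+
qed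

lemma lincomb_insert:
  "finite S \<Longrightarrow> t \<notin> S \<Longrightarrow> lincomb (insert t S) c F = (\<lambda>h n z. c t * F t h n z + lincomb S c F h n z)"
  by (simp add: lincomb_def)

lemma lincomb_in_opspan:
  assumes "finite S" "\<And>t. t \<in> S \<Longrightarrow> F t \<in> opspan A"
  shows "lincomb S c F \<in> opspan A"
  using assms
proof (induction S rule: finite_induct)
  case empty
  then show ?case by (simp add: lincomb_def opspan_zero)
next
  case (insert t S)
  then show ?case unfolding lincomb_insert[OF insert.hyps] by (intro opspan_comb) auto
qed

lemma opspan_range_lincomb:
  assumes "T \<in> opspan (range F)"
  shows "\<exists>S c. finite S \<and> T = lincomb S c F"
  using assms
proof induction
  case opspan_zero
  then show ?case by (intro exI[of _ "{}"]) (simp add: lincomb_def)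
next
  case (opspan_step T U b)
  then obtain S c t where S: "finite S" and U: "U = lincomb S c F" and T: "T = F t" by auto
  \<comment> \<open>If the index t already occurs in S, its old coefficient has to be added to the
    new one.\<close>
  define c' where "c' = c(t := b + (if t \<in> S then c t else 0))"
  have "lincomb (insert t (S - {t})) c' F = (\<lambda>h n z. b * T h n z + U h n z)"
  proof (cases "t \<in> S")
    case True
    have "lincomb S c F = (\<lambda>h n z. c t * F t h n z + lincomb (S - {t}) c F h n z)"
      using lincomb_insert[of "S - {t}" t c F] S True by (simp add: insert_absorb)
    moreover have "lincomb (S - {t}) c' F = lincomb (S - {t}) c F"
      unfolding lincomb_def c'_def by (intro ext sum.cong) auto
    ultimately show ?thesis using S True
      by (subst lincomb_insert) (simp_all add: T U c'_def algebra_simps)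
  next
    case False
    then have "lincomb S c' F = lincomb S c F"
      unfolding lincomb_def c'_def by (intro ext sum.cong) auto
    then show ?thesis using S False by (subst lincomb_insert) (simp_all add: T U c'_def)
  qed
  then show ?case using S by (intro exI[of _ "insert t (S - {t})"] exI[of _ c']) simp
qed

lemma opspan_in_Hsp:
  assumes "T \<in> opspan A" "\<forall>T\<in>A. range T \<subseteq> Hsp"
  shows "T h \<in> Hsp"
  using assms(1)
proof induction
  case opspan_zero
  show ?case by (rule zero_in_Hsp)
next
  case (opspan_step T U c)
  have "T h \<in> Hsp" by (rule subsetD[OF bspec[OF assms(2) opspan_step.hyps(1)] rangeI])
  then show ?case using opspan_step.IH by (rule Hsp_comb)
qed

text \<open>Linearity of the generators is available on \<open>Hsp\<close>, so the operators in A
  are required to take values there.\<close>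

lemma opspan_gen_op:
  assumes "T \<in> opspan A" and A: "\<forall>T\<in>A. range T \<subseteq> Hsp"
    and B: "\<And>T. T \<in> A \<Longrightarrow> gen_op g \<circ> T \<in> opspan B"
  shows "gen_op g \<circ> T \<in> opspan B"
  using assms(1)
proof induction
  case opspan_zero
  then show ?case by (simp add: comp_def gen_op_zero opspan.opspan_zero)
next
  case (opspan_step T U c)
  have "T h \<in> Hsp" for h using opspan_in_Hsp[OF opspan_base[OF opspan_step.hyps(1)] A] .
  moreover have "U h \<in> Hsp" for h using opspan_in_Hsp[OF opspan_step.hyps(2) A] .
  ultimately have "gen_op g \<circ> (\<lambda>h n z. c * T h n z + U h n z)
      = (\<lambda>h n z. c * (gen_op g \<circ> T) h n z + (gen_op g \<circ> U) h n z)"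
    by (simp add: comp_def gen_op_comb)
  then show ?case using opspan_comb[OF B[OF opspan_step.hyps(1)] opspan_step.IH] by simp
qed

section \<open>Normal ordering of words\<close>

lemma idH_in_Hsp: "idH h \<in> Hsp"
  by (simp add: idH_def zero_in_Hsp)

lemma mono_0: "mono (0, 0, 0) = idH"
  by (simp add: mono_def)

lemma delta_mono: "delta \<circ> mono (k, i, j) = mono (Suc k, i, j)"
  by (simp add: mono_def comp_assoc)

lemma e4_mono: "e4 \<circ> mono (0, i, j) = mono (0, Suc i, j)"
  by (simp add: mono_def comp_assoc)

lemma e6_mono: "e6 \<circ> mono (0, i, j) = mono (0, i, Suc j)"
proof -
  have "e6 ((e4 ^^ i) g) = (e4 ^^ i) (e6 g)" for g
    by (induction i) (simp_all add: e6_e4)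
  then show ?thesis by (simp add: mono_def fun_eq_iff)
qed

lemma mono_in_Hsp: "mono t h \<in> Hsp"
proof -
  have funpow: "(f ^^ m) g \<in> Hsp" if "g \<in> Hsp" "range f \<subseteq> Hsp" for f :: op and m g
    using that by (cases m) auto
  have "range delta \<subseteq> Hsp" "range e4 \<subseteq> Hsp" "range e6 \<subseteq> Hsp"
    using delta_in_Hsp e4_in_Hsp e6_in_Hsp by auto
  then show ?thesis
    by (cases t) (simp add: mono_def funpow idH_in_Hsp)
qed

text \<open>The filtration by the exponent of \<open>delta\<close>: composing with
  \<open>delta\<close> raises it by one, composing with \<open>e4\<close> or \<open>e6\<close>
  preserves it.\<close>

definition monos_le :: "nat \<Rightarrow> op set" where
  "monos_le K = {mono (k, i, j) | k i j. k \<le> K}"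

lemma monos_le_in_Hsp: "\<forall>T\<in>monos_le K. range T \<subseteq> Hsp"
  using mono_in_Hsp by (auto simp: monos_le_def)

lemma mono_in_monos_le: "k \<le> K \<Longrightarrow> mono (k, i, j) \<in> opspan (monos_le K)"
  unfolding monos_le_def by (blast intro: opspan_base)

lemma monos_le_cases:
  assumes "T \<in> monos_le K"
  obtains k i j where "T = mono (k, i, j)" "k \<le> K"
  using assms unfolding monos_le_def by blast

lemma delta_opspan:
  assumes "T \<in> opspan (monos_le K)"
  shows "delta \<circ> T \<in> opspan (monos_le (Suc K))"
proof -
  have "gen_op Gd \<circ> T \<in> opspan (monos_le (Suc K))"
  proof (rule opspan_gen_op[OF assms monos_le_in_Hsp])
    fix T assume "T \<in> monos_le K"
    then obtain k i j where "T = mono (k, i, j)" "k \<le> K" by (rule monos_le_cases)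
    then show "gen_op Gd \<circ> T \<in> opspan (monos_le (Suc K))"
      by (simp add: delta_mono mono_in_monos_le)
  qed
  then show ?thesis by simp
qed

text \<open>Both claims go into one induction, because moving \<open>e4\<close> past
  \<open>delta\<close> creates \<open>e6\<close>, and moving \<open>e6\<close> past
  \<open>delta\<close> creates two factors \<open>e4\<close>.\<close>

lemma e4_e6_opspan:
  assumes "T \<in> opspan (monos_le K)"
  shows "e4 \<circ> T \<in> opspan (monos_le K) \<and> e6 \<circ> T \<in> opspan (monos_le K)"
  using assms
proof (induction K arbitrary: T)
  have base: "e4 \<circ> mono (0, i, j) \<in> opspan (monos_le K)" "e6 \<circ> mono (0, i, j) \<in> opspan (monos_le K)" for i j K
    by (simp_all add: e4_mono e6_mono mono_in_monos_le)
  \<comment> \<open>By linearity it suffices to treat monomials.\<close>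
  have reduce: "e4 \<circ> T \<in> opspan (monos_le K) \<and> e6 \<circ> T \<in> opspan (monos_le K)"
    if "\<And>k i j. k \<le> K \<Longrightarrow> e4 \<circ> mono (k, i, j) \<in> opspan (monos_le K) \<and> e6 \<circ> mono (k, i, j) \<in> opspan (monos_le K)"
      and "T \<in> opspan (monos_le K)" for K T
  proof -
    have "gen_op G4 \<circ> T \<in> opspan (monos_le K)"
      by (rule opspan_gen_op[OF that(2) monos_le_in_Hsp]) (use that(1) in \<open>auto elim!: monos_le_cases\<close>)
    moreover have "gen_op G6 \<circ> T \<in> opspan (monos_le K)"
      by (rule opspan_gen_op[OF that(2) monos_le_in_Hsp]) (use that(1) in \<open>auto elim!: monos_le_cases\<close>)
    ultimately show ?thesis by simp
  qed
  {
    case 0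
    show ?case by (rule reduce[OF _ 0]) (simp add: base)
  next
    case (Suc K)
    have mon: "U \<in> opspan (monos_le (Suc K))" if "U \<in> opspan (monos_le K)" for U
      by (rule opspan_mono[OF _ that]) (unfold monos_le_def, blast intro: le_SucI)
    show ?case
    proof (rule reduce[OF _ Suc.prems])
      fix k i j assume k: "k \<le> Suc K"
      show "e4 \<circ> mono (k, i, j) \<in> opspan (monos_le (Suc K)) \<and> e6 \<circ> mono (k, i, j) \<in> opspan (monos_le (Suc K))"
      proof (cases k)
        case 0
        then show ?thesis using base by simp
      next
        case l: (Suc l)
        let ?V = "mono (l, i, j)"
        have V: "?V \<in> opspan (monos_le K)" using k l by (simp add: mono_in_monos_le)
        have eq: "e4 \<circ> mono (k, i, j) = (\<lambda>h n z. 1 / 3 * (e6 \<circ> ?V) h n z + (delta \<circ> (e4 \<circ> ?V)) h n z)"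
          "e6 \<circ> mono (k, i, j) = (\<lambda>h n z. 1 / 2 * (e4 \<circ> (e4 \<circ> ?V)) h n z + (delta \<circ> (e6 \<circ> ?V)) h n z)"
          unfolding l delta_mono[symmetric]
          by (simp_all add: fun_eq_iff e4_delta[OF mono_in_Hsp] e6_delta[OF mono_in_Hsp])
        have 4: "e4 \<circ> ?V \<in> opspan (monos_le K)" and 6: "e6 \<circ> ?V \<in> opspan (monos_le K)"
          using Suc.IH[OF V] by blast+
        \<comment> \<open>The induction hypothesis covers the whole span, so it applies again to
          \<open>e4 \<circ> ?V\<close>, in general no longer a monomial.\<close>
        have 44: "e4 \<circ> (e4 \<circ> ?V) \<in> opspan (monos_le K)" using Suc.IH[OF 4] by blast
        show ?thesis unfolding eq
          using opspan_comb[OF mon[OF 6] delta_opspan[OF 4]] opspan_comb[OF mon[OF 44] delta_opspan[OF 6]]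
          by (rule conjI)
      qed
    qed
  }
qed

lemma gen_op_mono_opspan: "gen_op g \<circ> mono t \<in> opspan (range mono)"
proof -
  obtain k i j where t: "t = (k, i, j)" by (cases t)
  have V: "mono t \<in> opspan (monos_le k)" by (simp add: t mono_in_monos_le)
  have sub: "U \<in> opspan (range mono)" if "U \<in> opspan (monos_le K)" for U K
    by (rule opspan_mono[OF _ that]) (auto simp: monos_le_def)
  show ?thesis
    using sub[OF delta_opspan[OF V]] e4_e6_opspan[OF V] sub[of _ k] by (cases g) simp_all
qed

lemma word_op_opspan: "word_op w \<in> opspan (range mono)"
proof (induction w)
  case Nil
  show ?case using opspan_base[OF rangeI, of mono "(0, 0, 0)"] by (simp add: mono_0)
next
  case (Cons g w)
  have "gen_op g \<circ> word_op w \<in> opspan (range mono)"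
  proof (rule opspan_gen_op[OF Cons])
    show "\<forall>T\<in>range mono. range T \<subseteq> Hsp" using mono_in_Hsp by auto
  next
    fix T assume "T \<in> range mono"
    then show "gen_op g \<circ> T \<in> opspan (range mono)" using gen_op_mono_opspan by blast
  qed
  then show ?case by (simp add: comp_def)
qed

lemma mono_in_Ralg: "mono t \<in> Ralg"
proof -
  obtain k i j where t: "t = (k, i, j)" by (cases t)
  let ?w = "replicate k Gd @ replicate i G4 @ replicate j G6"
  have app: "word_op (replicate m g @ w) = (gen_op g ^^ m) \<circ> word_op w" for m g w
    by (induction m) (simp_all add: comp_assoc)
  have "word_op ?w = mono t"
    using app[of j G6 "[]"] by (simp add: app t mono_def comp_assoc)
  then have "mono t = lincomb {?w} (\<lambda>_. 1) word_op" by (simp add: lincomb_def)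
  then show ?thesis unfolding Ralg_def by blast
qed

lemma Ralg_spanned:
  assumes "T \<in> Ralg"
  shows "\<exists>S c. finite S \<and> T = lincomb S c mono"
proof -
  obtain W c where "finite W" "T = lincomb W c word_op" using assms unfolding Ralg_def by blast
  then have "T \<in> opspan (range mono)" using lincomb_in_opspan[of W word_op] word_op_opspan by blast
  then show ?thesis by (rule opspan_range_lincomb)
qed

section \<open>Independence\<close>

text \<open>A nonconstant series satisfies no polynomial equation. Composition needs a series
  without constant term, so p(X) is rewritten as q(X - 1) and q is composed with r - 1; composition
  with a nonzero such series is injective.\<close>

lemma fps_power_independent:
  fixes r :: "complex fps"
  assumes r0: "fps_nth r 0 = 1" and r1: "r \<noteq> 1" and M: "finite M"
    and zero: "(\<Sum>m\<in>M. fps_const (c m) * r ^ m) = 0" and m: "m \<in> M"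
  shows "c m = 0"
proof -
  define p where "p = (\<Sum>m\<in>M. monom (c m) m)"
  define q where "q = (\<Sum>m\<in>M. smult (c m) ([:1, 1:] ^ m))"
  have "fps_of_poly q = (\<Sum>m\<in>M. fps_const (c m) * (1 + fps_X) ^ m)"
    by (simp add: q_def fps_of_poly_sum fps_of_poly_smult fps_of_poly_power fps_of_poly_linear')
  then have "fps_of_poly q oo (r - 1) = (\<Sum>m\<in>M. fps_const (c m) * r ^ m)"
    using r0
    by (simp add: fps_compose_sum_distrib fps_compose_mult_distrib fps_compose_add_distrib
        flip: fps_compose_power)
  then have "fps_of_poly q = 0"
    using zero r0 r1 fps_compose_eq_0_iff[of "r - 1" "fps_of_poly q"] by auto
  then have "q = 0" by (metis fps_of_poly_0 fps_of_poly_eq_iff)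
  moreover have "poly p x = poly q (x - 1)" for x
    by (simp add: p_def q_def poly_sum poly_monom)
  ultimately have "p = 0" by (simp add: poly_all_0_iff_0[symmetric])
  moreover have "coeff p m = c m"
    using M m by (simp add: p_def coeff_sum)
  ultimately show ?thesis by simp
qed

text \<open>Monomials of equal weight differ by powers of \<open>y\<^sup>2 / x\<^sup>3\<close>, a nonconstant power series.\<close>

lemma fps_weighted_independent:
  fixes x y :: "complex fps"
  assumes x0: "fps_nth x 0 = 1" and y0: "fps_nth y 0 = 1" and xy: "y ^ 2 \<noteq> x ^ 3" and S: "finite S"
    and wt: "\<And>i j. (i, j) \<in> S \<Longrightarrow> 2 * i + 3 * j = v"
    and zero: "(\<Sum>(i, j)\<in>S. fps_const (c (i, j)) * (x ^ i * y ^ j)) = 0" and t: "t \<in> S"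
  shows "c t = 0"
proof -
  \<comment> \<open>Since 2 i + 3 j = v, every j has the parity e of v. With m = j div 2 this gives
    x^i y^j = x^A y^e r^m, where A = i + 3 m does not depend on the pair.\<close>
  define e A where "e = v mod 2" and "A = (v - 3 * e) div 2"
  define r where "r = y ^ 2 * inverse (x ^ 3)"
  define J where "J = (\<lambda>(i::nat, j::nat). j div 2)"
  have x3: "x ^ 3 * inverse (x ^ 3) = 1" using x0 by (simp add: inverse_mult_eq_1')
  have r: "r * x ^ 3 = y ^ 2" using x3 by (simp add: r_def mult.assoc mult.commute)
  have r0: "fps_nth r 0 = 1" using x0 y0 by (simp add: r_def fps_power_zeroth)
  have r1: "r \<noteq> 1" using r xy by auto
  have idx: "j = e + 2 * (j div 2) \<and> i + 3 * (j div 2) = A" if "(i, j) \<in> S" for i j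
  proof -
    have "e = j mod 2" unfolding e_def wt[OF that, symmetric] by presburger
    then have j: "j = e + 2 * (j div 2)" by simp
    moreover from j have "3 * j = 3 * e + 6 * (j div 2)" by simp
    then have "v = 3 * e + 2 * (i + 3 * (j div 2))" using wt[OF that] by simp
    then have "(v - 3 * e) div 2 = i + 3 * (j div 2)" by simp
    ultimately show ?thesis unfolding A_def by simp
  qed
  have inj: "inj_on J S"
  proof (rule inj_onI)
    fix s u assume su: "s \<in> S" "u \<in> S" "J s = J u"
    obtain i j k l where [simp]: "s = (i, j)" "u = (k, l)" by (cases s, cases u)
    show "s = u" using idx[of i j] idx[of k l] su unfolding J_def by auto
  qed
  have summand: "x ^ i * y ^ j = x ^ A * y ^ e * r ^ J (i, j)" if "(i, j) \<in> S" for i j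
  proof -
    let ?m = "j div 2"
    have "x ^ A * y ^ e * r ^ ?m = x ^ (i + 3 * ?m) * y ^ e * r ^ ?m" using idx[OF that] by simp
    also have "\<dots> = x ^ i * y ^ e * (r * x ^ 3) ^ ?m"
      by (simp add: power_add power_mult power_mult_distrib mult_ac)
    also have "\<dots> = x ^ i * y ^ (e + 2 * ?m)" unfolding r by (simp add: power_add power_mult mult_ac)
    finally show ?thesis using idx[OF that] by (simp add: J_def)
  qed
  have "(\<Sum>(i, j)\<in>S. fps_const (c (i, j)) * (x ^ i * y ^ j))
    = x ^ A * y ^ e * (\<Sum>s\<in>S. fps_const (c s) * r ^ J s)"
    unfolding sum_distrib_left by (intro sum.cong refl) (auto simp: summand mult_ac)
  moreover have "x ^ A * y ^ e \<noteq> 0" using x0 y0 by auto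
  ultimately have "(\<Sum>s\<in>S. fps_const (c s) * r ^ J s) = 0" using zero by (metis mult_eq_0_iff)
  moreover have "(\<Sum>s\<in>S. fps_const (c s) * r ^ J s)
      = (\<Sum>m\<in>J ` S. fps_const (c (the_inv_into S J m)) * r ^ m)"
    by (subst sum.reindex[OF inj]) (auto simp: the_inv_into_f_f[OF inj])
  ultimately have "c (the_inv_into S J (J t)) = 0"
    using fps_power_independent[OF r0 r1, of "J ` S" "\<lambda>m. c (the_inv_into S J m)"] S t by simp
  then show ?thesis using the_inv_into_f_f[OF inj t] by simp
qed

section \<open>From functions on the upper half plane to power series in q\<close>

lemma has_fps_expansion_power:
  fixes f :: "complex \<Rightarrow> complex"
  shows "f has_fps_expansion F \<Longrightarrow> (\<lambda>z. f z ^ n) has_fps_expansion F ^ n"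
  by (induction n) (auto intro: has_fps_expansion_mult)

text \<open>Every point of the punctured unit disc is a value of q, so a relation on the upper half
  plane holds on that disc.\<close>

lemma qq_surj:
  assumes "q \<noteq> 0" "norm q < 1"
  obtains z where "z \<in> uhp" "qq z = q"
proof
  let ?z = "Ln q / (2 * pi * \<i>)"
  show "qq ?z = q" using assms by (simp add: qq_def)
  have "?z = - \<i> * (Ln q / complex_of_real (2 * pi))" by (simp add: field_simps)
  then have "Im ?z = - (Re (Ln q) / (2 * pi))" by (simp add: Re_divide_of_real)
  moreover have "Re (Ln q) < 0" using assms by (simp add: ln_less_zero)
  ultimately show "?z \<in> uhp" unfolding uhp_def by (simp add: divide_less_0_iff)
qed

lemma eis_fps_4_6_not_equal: "eis_fps 6 (-504) ^ 2 \<noteq> eis_fps 4 240 ^ 3"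
proof
  assume "eis_fps 6 (-504) ^ 2 = eis_fps 4 240 ^ 3"
  then have "fps_nth (eis_fps 6 (-504) ^ 2) 1 = fps_nth (eis_fps 4 240 ^ 3) 1" by simp
  \<comment> \<open>The coefficients of q are 2 (-504) = -1008 and 3 * 240 = 720.\<close>
  then show False by (simp add: power2_eq_square power3_eq_cube eis_fps_def divsum_def)
qed

text \<open>Here v is half the common weight 4 i + 6 j. The relation becomes one between functions
  of q near 0, hence between q-expansions.\<close>

lemma E4_E6_independent:
  assumes S: "finite S" and wt: "\<And>i j. (i, j) \<in> S \<Longrightarrow> 2 * i + 3 * j = v"
    and zero: "\<And>z. z \<in> uhp \<Longrightarrow> (\<Sum>(i, j)\<in>S. c (i, j) * (E4 z ^ i * E6 z ^ j)) = 0" and t: "t \<in> S"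
  shows "c t = 0"
proof -
  let ?F = "eis_fps 4 240" and ?G = "eis_fps 6 (-504)"
  define f where "f q = (\<Sum>(i, j)\<in>S. c (i, j) * (eval_fps ?F q ^ i * eval_fps ?G q ^ j))" for q
  define H where "H = (\<Sum>(i, j)\<in>S. fps_const (c (i, j)) * (?F ^ i * ?G ^ j))"
  have exp: "eval_fps (eis_fps k d) has_fps_expansion eis_fps k d" for k d
    by (rule eval_fps_has_fps_expansion, rule less_le_trans[OF _ eis_fps_conv_radius]) simp
  have f: "f has_fps_expansion H"
    unfolding f_def H_def case_prod_unfold
    by (intro has_fps_expansion_sum has_fps_expansion_mult has_fps_expansion_power has_fps_expansion_const exp)
  \<comment> \<open>The factor \<open>q\<close> takes care of \<open>q = 0\<close>, which is not a value of \<^const>\<open>qq\<close>.\<close>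
  have Xf: "(\<lambda>q. q * f q) has_fps_expansion fps_X * H"
    by (intro has_fps_expansion_mult has_fps_expansion_fps_X f)
  have qf: "q * f q = 0" if q: "norm q < 1" for q
  proof (cases "q = 0")
    case False
    obtain z where z: "z \<in> uhp" "qq z = q" by (rule qq_surj[OF False q])
    then have "f q = (\<Sum>(i, j)\<in>S. c (i, j) * (E4 z ^ i * E6 z ^ j))"
      by (simp add: f_def E4_def E6_def Eis_eq_eval_fps)
    then show ?thesis using zero[OF z(1)] by simp
  qed simp
  have "eventually (\<lambda>q::complex. norm q < 1) (nhds 0)"
    using eventually_nhds_in_open[of "ball 0 1" "0 :: complex"] by simp
  moreover have "eventually (\<lambda>q. eval_fps (fps_X * H) q = q * f q) (nhds 0)"
    using Xf by (simp add: has_fps_expansion_def)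
  ultimately have "eventually (\<lambda>q. eval_fps (fps_X * H) q = eval_fps 0 q) (nhds 0)"
    by eventually_elim (use qf in simp)
  with Xf have "fps_X * H = 0" by (intro eval_fps_eqD) (auto simp: has_fps_expansion_def)
  then have H0: "(\<Sum>(i, j)\<in>S. fps_const (c (i, j)) * (?F ^ i * ?G ^ j)) = 0" by (simp add: H_def)
  have "fps_nth ?F 0 = 1" "fps_nth ?G 0 = 1" by (simp_all add: eis_fps_def)
  from fps_weighted_independent[OF this eis_fps_4_6_not_equal S wt H0 t] show ?thesis .
qed

section \<open>Test elements vanishing to prescribed order at a point\<close>

definition oneH :: hel where
  "oneH = (\<lambda>n z. if n = 0 \<and> z \<in> uhp then 1 else 0)"

lemma oneH_in_Hsp: "oneH \<in> Hsp"
proof -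
  have "{n. oneH n \<noteq> (\<lambda>z. 0)} \<subseteq> {0}" by (auto simp: oneH_def fun_eq_iff)
  moreover have "oneH n holomorphic_on uhp" for n
    by (rule holomorphic_transform[of "\<lambda>z. if n = 0 then 1 else 0"]) (auto simp: oneH_def)
  ultimately show ?thesis by (auto simp: Hsp_def oneH_def intro: finite_subset)
qed

definition shift2 :: op where
  "shift2 h = (\<lambda>n. h (n - 2))"

definition zpow :: "complex \<Rightarrow> nat \<Rightarrow> op" where
  "zpow w m h = (\<lambda>n z. (z - w) ^ m * h n z)"

lemma shift2_in_Hsp: "h \<in> Hsp \<Longrightarrow> shift2 h \<in> Hsp"
  unfolding shift2_def by (rule Hsp_shift[where \<Phi> = "\<lambda>m f. f"]) (auto simp: Hsp_outside)

lemma shift2_funpow_in_Hsp: "h \<in> Hsp \<Longrightarrow> (shift2 ^^ k) h \<in> Hsp"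
  by (induction k) (simp_all add: shift2_in_Hsp)

lemma shift2_funpow: "(shift2 ^^ k) h n = h (n - 2 * real k)"
  by (induction k arbitrary: n) (simp_all add: shift2_def algebra_simps)

lemma zpow_in_Hsp:
  assumes "h \<in> Hsp" shows "zpow w m h \<in> Hsp"
proof -
  have "finite {n. (\<lambda>z. (z - w) ^ m * h n z) \<noteq> (\<lambda>z. 0)}"
    by (rule finite_subset[of _ "{n. h n \<noteq> (\<lambda>z. 0)}"]) (use assms in \<open>auto simp: Hsp_def\<close>)
  then show ?thesis using assms by (auto simp: Hsp_def zpow_def intro!: holomorphic_intros)
qed

lemma e4_zpow: "h \<in> Hsp \<Longrightarrow> e4 (zpow w m h) = zpow w m (e4 h)"
  using zpow_in_Hsp[of h w m] by (simp add: e4_def zpow_def fun_eq_iff mult_ac)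

lemma e6_zpow: "h \<in> Hsp \<Longrightarrow> e6 (zpow w m h) = zpow w m (e6 h)"
  using zpow_in_Hsp[of h w m] by (simp add: e6_def zpow_def fun_eq_iff mult_ac)

lemma e4_apply: "h \<in> Hsp \<Longrightarrow> e4 h n z = E4 z * h (n - 4) z"
  by (simp add: e4_def)

lemma e6_apply: "h \<in> Hsp \<Longrightarrow> e6 h n z = E6 z * h (n - 6) z"
  by (simp add: e6_def)

lemma delta_zpow:
  assumes h: "h \<in> Hsp"
  shows "delta (zpow w (Suc m) h)
    = (\<lambda>n z. of_nat (Suc m) / (2 * pi * \<i>) * zpow w m (shift2 h) n z + zpow w (Suc m) (delta h) n z)"
proof (intro ext)
  fix n z
  show "delta (zpow w (Suc m) h) n z
    = of_nat (Suc m) / (2 * pi * \<i>) * zpow w m (shift2 h) n z + zpow w (Suc m) (delta h) n z"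
  proof (cases "z \<in> uhp")
    case z: True
    have "((\<lambda>z. (z - w) ^ Suc m) has_field_derivative
        2 * pi * \<i> * (of_nat (Suc m) / (2 * pi * \<i>) * (z - w) ^ m)) (at z)"
      by (auto intro!: derivative_eq_intros simp del: power_Suc)
    \<comment> \<open>The weights k and l coincide, so the power of z - w counts as weight 0 and
      produces no term with E2.\<close>
    from Dk_mult[OF this Hsp_differentiable[OF h z], of "n - 2" "n - 2" "n - 2"]
    have "Dk (n - 2) (\<lambda>z. (z - w) ^ Suc m * h (n - 2) z) z
      = (z - w) ^ Suc m * Dk (n - 2) (h (n - 2)) z
        + of_nat (Suc m) / (2 * pi * \<i>) * (z - w) ^ m * h (n - 2) z"
      by (simp del: power_Suc of_nat_Suc)
    then show ?thesis using z h zpow_in_Hsp[OF h, of w "Suc m"]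
      by (simp add: delta_def zpow_def shift2_def del: power_Suc of_nat_Suc)
  next
    case False
    then show ?thesis
      using Hsp_outside[OF h] Hsp_outside[OF delta_in_Hsp] by (simp add: zpow_def shift2_def)
  qed
qed

lemma delta_comb:
  "h \<in> Hsp \<Longrightarrow> g \<in> Hsp \<Longrightarrow> delta (\<lambda>n z. c * h n z + g n z) = (\<lambda>n z. c * delta h n z + delta g n z)"
  using gen_op_comb[of h g Gd c] by simp

text \<open>Each \<^const>\<open>delta\<close> lowers the order of vanishing at \<open>w\<close> by at most one; the leading term only
  involves \<open>h\<close> itself, moved up by the degree 2 of \<^const>\<open>delta\<close>.\<close>

lemma delta_funpow_zpow:
  assumes h: "h \<in> Hsp"
  shows "k \<le> K \<Longrightarrow> \<exists>r\<in>Hsp. (delta ^^ k) (zpow w K h)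
    = (\<lambda>n z. fact K / (fact (K - k) * (2 * pi * \<i>) ^ k) * zpow w (K - k) ((shift2 ^^ k) h) n z
        + zpow w (Suc (K - k)) r n z)"
proof (induction k)
  case 0
  show ?case by (intro bexI[of _ "\<lambda>n z. 0"] zero_in_Hsp) (simp add: zpow_def)
next
  case (Suc k)
  define m where "m = K - Suc k"
  have m: "K - k = Suc m" using Suc.prems by (simp add: m_def)
  define C :: complex where "C = fact K / (fact (Suc m) * (2 * pi * \<i>) ^ k)"
  define g where "g = (shift2 ^^ k) h"
  have g: "g \<in> Hsp" using h by (simp add: g_def shift2_funpow_in_Hsp)
  obtain r where r: "r \<in> Hsp" and IH: "(delta ^^ k) (zpow w K h)
      = (\<lambda>n z. C * zpow w (Suc m) g n z + zpow w (Suc (Suc m)) r n z)"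
    using Suc unfolding m C_def g_def by auto
  define a b :: complex where "a = of_nat (Suc m) / (2 * pi * \<i>)"
    and "b = of_nat (Suc (Suc m)) / (2 * pi * \<i>)"
  \<comment> \<open>Collects everything divisible by (z - w)^(m + 1). The last term has one zero
    more than required, hence the factor \<open>zpow w 1\<close>.\<close>
  define r' where "r' = (\<lambda>n z. C * delta g n z + (b * shift2 r n z + zpow w 1 (delta r) n z))"
  have r': "r' \<in> Hsp"
    unfolding r'_def by (intro Hsp_comb delta_in_Hsp zpow_in_Hsp shift2_in_Hsp r)
  have C: "C * a = fact K / (fact m * (2 * pi * \<i>) ^ Suc k)"
    unfolding C_def a_def by (simp add: divide_simps del: of_nat_Suc)
  have ident: "C * (a * (u ^ m * s) + u ^ Suc m * d) + (b * (u ^ Suc m * s') + u ^ Suc (Suc m) * d')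
      = C * a * (u ^ m * s) + u ^ Suc m * (C * d + (b * s' + u ^ 1 * d'))" for u s s' d d' :: complex
    by (simp add: algebra_simps)
  have "(delta ^^ Suc k) (zpow w K h)
    = (\<lambda>n z. C * delta (zpow w (Suc m) g) n z + delta (zpow w (Suc (Suc m)) r) n z)"
    using IH zpow_in_Hsp[OF g] zpow_in_Hsp[OF r] by (simp add: delta_comb)
  also have "\<dots> = (\<lambda>n z. (C * a) * zpow w m (shift2 g) n z + zpow w (Suc m) r' n z)"
    unfolding delta_zpow[OF g] delta_zpow[OF r] a_def[symmetric] b_def[symmetric] unfolding r'_def zpow_def
    by (intro ext ident)
  also have "shift2 g = (shift2 ^^ Suc k) h" by (simp add: g_def)
  finally show ?case unfolding C m_def[symmetric] using r' by blast
qed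

text \<open>\<open>e4\<close> and \<open>e6\<close> commute with powers of z - w, so
  \<open>delta_funpow_zpow\<close> applies. At z = w its remainder vanishes, and its leading term
  carries 0^(K - k), which is nonzero only for k = K.\<close>

lemma mono_zpow_oneH:
  assumes w: "w \<in> uhp" and k: "k \<le> K"
  shows "mono (k, i, j) (zpow w K oneH) n w
    = (if k = K \<and> n = 2 * real K + 4 * real i + 6 * real j
       then fact K / (2 * pi * \<i>) ^ K * (E4 w ^ i * E6 w ^ j) else 0)"
proof -
  define h where "h = (e4 ^^ i) ((e6 ^^ j) oneH)"
  have one: "oneH n w = (if n = 0 then 1 else 0)" for n using w by (simp add: oneH_def)
  have 6: "(e6 ^^ j) oneH \<in> Hsp" "(e6 ^^ j) (zpow w K oneH) = zpow w K ((e6 ^^ j) oneH)" for j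
    by (induction j) (simp_all add: oneH_in_Hsp e6_in_Hsp e6_zpow)
  have 4: "(e4 ^^ i) ((e6 ^^ j) oneH) \<in> Hsp"
    "(e4 ^^ i) (zpow w K ((e6 ^^ j) oneH)) = zpow w K ((e4 ^^ i) ((e6 ^^ j) oneH))" for i
    by (induction i) (simp_all add: 6 e4_in_Hsp e4_zpow)
  have h6: "(e6 ^^ j) oneH n w = (if n = 6 * real j then E6 w ^ j else 0)" for n
  proof (induction j arbitrary: n)
    case (Suc j)
    have "(e6 ^^ Suc j) oneH n w = E6 w * (e6 ^^ j) oneH (n - 6) w" using e6_apply[OF 6(1)] by simp
    then show ?case unfolding Suc by simp
  qed (simp add: one)
  have "(e4 ^^ i) ((e6 ^^ j) oneH) n w = (if n = 4 * real i + 6 * real j then E4 w ^ i * E6 w ^ j else 0)" for n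
  proof (induction i arbitrary: n)
    case (Suc i)
    have "(e4 ^^ Suc i) ((e6 ^^ j) oneH) n w = E4 w * (e4 ^^ i) ((e6 ^^ j) oneH) (n - 4) w"
      using e4_apply[OF 4(1)] by simp
    then show ?case unfolding Suc by simp
  qed (simp add: h6)
  then have hw: "h n w = (if n = 4 * real i + 6 * real j then E4 w ^ i * E6 w ^ j else 0)" for n
    by (simp add: h_def)
  have h: "h \<in> Hsp" using 4(1) by (simp add: h_def)
  have "mono (k, i, j) (zpow w K oneH) = (delta ^^ k) (zpow w K h)"
    using zpow_in_Hsp[OF oneH_in_Hsp] by (simp add: mono_def idH_def h_def 6 4)
  moreover obtain r where "(delta ^^ k) (zpow w K h)
    = (\<lambda>n z. fact K / (fact (K - k) * (2 * pi * \<i>) ^ k) * zpow w (K - k) ((shift2 ^^ k) h) n z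
        + zpow w (Suc (K - k)) r n z)"
    using delta_funpow_zpow[OF h k, of w] by blast
  ultimately have "mono (k, i, j) (zpow w K oneH) n w
    = fact K / (fact (K - k) * (2 * pi * \<i>) ^ k) * (0 ^ (K - k) * h (n - 2 * real k) w)"
    by (simp add: zpow_def shift2_funpow)
  then show ?thesis using k by (auto simp: hw power_0_left)
qed

lemma mono_independent:
  assumes S: "finite S" and zero: "lincomb S c mono = (\<lambda>h n z. 0)" and t: "t \<in> S"
  shows "c t = 0"
proof (rule ccontr)
  assume ct: "c t \<noteq> 0"
  \<comment> \<open>Discarding zero coefficients makes K the largest exponent of
    \<open>delta\<close> that really occurs; terms of S with larger exponent have coefficient
    0.\<close>
  define S' where "S' = {s\<in>S. c s \<noteq> 0}"
  have "t \<in> S'" using t ct by (simp add: S'_def)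
  moreover have "finite S'" using S by (simp add: S'_def)
  ultimately have S': "finite S'" "S' \<noteq> {}" by auto
  define K where "K = Max (fst ` S')"
  have le: "k \<le> K" if "(k, i, j) \<in> S'" for k i j
    unfolding K_def using that S' by (intro Max_ge) force+
  have "K \<in> fst ` S'" unfolding K_def using S' by (intro Max_in) auto
  then obtain i0 j0 where ij0: "(K, i0, j0) \<in> S'" by force
  define v where "v = 2 * i0 + 3 * j0"
  \<comment> \<open>The terms of top exponent K and the weight of one chosen term. They are isolated
    below by evaluating in degree 2 K + 4 i + 6 j = 2 K + 2 v.\<close>
  define P where "P = {(i, j). (K, i, j) \<in> S' \<and> 2 * i + 3 * j = v}"
  have inj: "inj_on (Pair K) P" by (auto intro: inj_onI)
  have P: "finite P"
    by (rule finite_imageD[OF finite_subset[OF _ S'(1)] inj]) (auto simp: P_def)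
  have "(\<Sum>(i, j)\<in>P. c (K, i, j) * (E4 w ^ i * E6 w ^ j)) = 0" if w: "w \<in> uhp" for w
  proof -
    let ?n = "2 * real K + 2 * real v" and ?C = "fact K / (2 * pi * \<i>) ^ K :: complex"
    have "0 = lincomb S c mono (zpow w K oneH) ?n w" by (simp add: zero)
    also have "\<dots> = (\<Sum>s\<in>S. c s * mono s (zpow w K oneH) ?n w)" by (simp add: lincomb_def)
    also have "\<dots> = (\<Sum>s\<in>Pair K ` P. c s * mono s (zpow w K oneH) ?n w)"
    proof (rule sum.mono_neutral_right[OF S])
      show "Pair K ` P \<subseteq> S" by (auto simp: P_def S'_def)
      show "\<forall>s\<in>S - Pair K ` P. c s * mono s (zpow w K oneH) ?n w = 0"
      proof
        fix s assume s: "s \<in> S - Pair K ` P"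
        obtain k i j where kij: "s = (k, i, j)" by (cases s)
        show "c s * mono s (zpow w K oneH) ?n w = 0"
        proof (cases "c s = 0")
          case False
          then have sS: "(k, i, j) \<in> S'" using s kij by (simp add: S'_def)
          have "\<not> (k = K \<and> 2 * i + 3 * j = v)" using s sS by (auto simp: P_def kij)
          then have "\<not> (k = K \<and> ?n = 2 * real K + 4 * real i + 6 * real j)" by linarith
          then show ?thesis unfolding kij mono_zpow_oneH[OF w le[OF sS]] by (simp only: if_False mult_zero_right)
        qed simp
      qed
    qed
    also have "\<dots> = (\<Sum>(i, j)\<in>P. c (K, i, j) * (?C * (E4 w ^ i * E6 w ^ j)))"
    proof (subst sum.reindex[OF inj], intro sum.cong refl)
      fix s assume "s \<in> P"
      then obtain i j where s: "s = (i, j)" "2 * i + 3 * j = v" by (auto simp: P_def)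
      then have "?n = 2 * real K + 4 * real i + 6 * real j" by linarith
      then show "((\<lambda>s. c s * mono s (zpow w K oneH) ?n w) \<circ> Pair K) s
          = (case s of (i, j) \<Rightarrow> c (K, i, j) * (?C * (E4 w ^ i * E6 w ^ j)))"
        by (simp add: s mono_zpow_oneH[OF w order_refl])
    qed
    also have "\<dots> = ?C * (\<Sum>(i, j)\<in>P. c (K, i, j) * (E4 w ^ i * E6 w ^ j))"
      unfolding sum_distrib_left by (intro sum.cong refl) (simp add: case_prod_unfold)
    finally show ?thesis by simp
  qed
  moreover have "(i0, j0) \<in> P" using ij0 by (simp add: P_def v_def)
  ultimately have "c (K, i0, j0) = 0"
    by (intro E4_E6_independent[where c = "\<lambda>s. c (K, s)" and v = v, OF P]) (simp_all add: P_def)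
  then show False using ij0 by (simp add: S'_def)
qed

theorem theorem3p4:
  shows "(\<forall>t. mono t \<in> Ralg)
    \<and> (\<forall>T\<in>Ralg. \<exists>S c. finite S \<and> T = lincomb S c mono)
    \<and> (\<forall>S c. finite S \<and> lincomb S c mono = (\<lambda>h n z. 0) \<longrightarrow> (\<forall>t\<in>S. c t = 0))"
  using mono_in_Ralg Ralg_spanned mono_independent by blast

end
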